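(* Let $G_1=K_{1,4}$ be the star with four edges and $G_2=C_4+K_1$ the disjoint union of a $4$-cycle and an isolated vertex. For $n\ge 2$ let $P_n$ be a path on $n$ vertices with one of its pendent vertices as root. Then the rooted products $G_1(P_n)$ and $G_2(P_n)$ are not high-ordered cospectral.
   Context: Graphs are finite, simple and undirected, not necessarily connected. For a graph $G$ and a rooted graph $\Gamma$, the rooted product $G(\Gamma)$ is the graph obtained by identifying each vertex of $G$ with the root of its own copy of $\Gamma$. For a graph $G=(V,E)$ and $m\ge 2$, the $m$-th power $G^m$ is the $m$-uniform hypergraph obtained by enlarging every edge $e\in E$ by $m-2$ new vertices $i_{e,1},\dots,i_{e,m-2}$ (new vertices for different edges being distinct); $G^2=G$. The adjacency tensor of an $m$-uniform hypergraph $\mathcal H$ on vertices $v_1,\dots,v_N$ is the order-$m$ dimension-$N$ tensor $\mathcal A=(a_{i_1\dots i_m})$ with $a_{i_1\dots i_m}=\frac1{(m-1)!}$ if $\{v_{i_1},\dots,v_{i_m}\}\in E(\mathcal H)$ and $0$ otherwise. With $(\mathcal A x^{m-1})_i=\sum_{i_2,\dots,i_m}a_{ii_2\dots i_m}x_{i_2}\cdots x_{i_m}$, the eigenvalues of $\mathcal H$ are the $\lambda\in\mathbb C$ for which $\mathcal A x^{m-1}=\lambda x^{[m-1]}$, $x^{[m-1]}=(x_1^{m-1},\dots,x_N^{m-1})$, has a nonzero solution; the spectrum of $\mathcal H$ is the multiset of the $N(m-1)^{N-1}$ roots of the characteristic polynomial, i.e. the resultant of the system $\lambda x^{[m-1]}-\mathcal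 A x^{m-1}=0$. Two graphs $G_1,G_2$ are high-ordered cospectral if $G_1^m$ and $G_2^m$ have the same spectrum for all $m\ge 2$. *)

theory Defs
  imports Complex_Main
    "HOL-Library.Multiset"
    "HOL-Library.Poly_Mapping"
    "HOL-Computational_Algebra.Computational_Algebra"
begin

section \<open>Graphs and hypergraphs\<close>

text \<open>
  A graph is a hypergraph all of whose edges have two elements.
\<close>

record 'a hypergraph =
  verts :: "'a set"
  edges :: "'a set set"

definition star_graph :: "nat \<Rightarrow> nat hypergraph" where
  "star_graph k = \<lparr>verts = {0..k}, edges = {{0, i} |i. i \<in> {1..k}}\<rparr>"

text \<open>Only meaningful for at least three vertices.\<close>

definition cycle_graph :: "nat \<Rightarrow> nat hypergraph" where
  "cycle_graph k = \<lparr>verts = {..<k}, edges = {{i, Suc i mod k} |i. i < k}\<rparr>"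

definition complete_graph :: "nat \<Rightarrow> nat hypergraph" where
  "complete_graph k = \<lparr>verts = {..<k}, edges = {e. e \<subseteq> {..<k} \<and> card e = 2}\<rparr>"

definition path_graph :: "nat \<Rightarrow> nat hypergraph" where
  "path_graph n = \<lparr>verts = {..<n}, edges = {{i, Suc i} |i. Suc i < n}\<rparr>"

definition disjoint_union :: "'a hypergraph \<Rightarrow> 'b hypergraph \<Rightarrow> ('a + 'b) hypergraph" where
  "disjoint_union G H =
     \<lparr>verts = Inl ` verts G \<union> Inr ` verts H,
      edges = (image Inl) ` edges G \<union> (image Inr) ` edges H\<rparr>"

definition pendent_vertex :: "'a hypergraph \<Rightarrow> 'a \<Rightarrow> bool" where
  "pendent_vertex G v \<longleftrightarrow> v \<in> verts G \<and> card {e \<in> edges G. v \<in> e} = 1"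

text \<open>
  The pair \<open>(v, w)\<close> is the vertex \<open>w\<close> in the copy of \<open>\<Gamma>\<close> attached at \<open>v\<close>; the vertex \<open>v\<close>
  of \<open>G\<close> is identified with \<open>(v, r)\<close>, where \<open>r\<close> is the root of \<open>\<Gamma>\<close>.
\<close>

definition rooted_product ::
  "'a hypergraph \<Rightarrow> 'b hypergraph \<Rightarrow> 'b \<Rightarrow> ('a \<times> 'b) hypergraph" where
  "rooted_product G \<Gamma> r =
     \<lparr>verts = verts G \<times> verts \<Gamma>,
      edges = {(\<lambda>v. (v, r)) ` e |e. e \<in> edges G} \<union>
              {Pair v ` f |v f. v \<in> verts G \<and> f \<in> edges \<Gamma>}\<rparr>"

text \<open>
  The new vertex \<open>i\<^bsub>e,j\<^esub>\<close> is \<open>Inr (e, j)\<close>. For \<open>m = 2\<close> there are no new vertices, and the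
  power is the copy of \<open>G\<close> under \<open>Inl\<close>.
\<close>

definition power_hypergraph ::
  "nat \<Rightarrow> 'a hypergraph \<Rightarrow> ('a + 'a set \<times> nat) hypergraph" where
  "power_hypergraph m G =
     \<lparr>verts = Inl ` verts G \<union> Inr ` (edges G \<times> {1..m - 2}),
      edges = {Inl ` e \<union> Inr ` ({e} \<times> {1..m - 2}) |e. e \<in> edges G}\<rparr>"


section \<open>Multivariate polynomials\<close>

text \<open>
  A polynomial is a finitely supported family of coefficients indexed by the exponent vectors
  of monomials.
\<close>

type_synonym 'v monomial = "'v \<Rightarrow>\<^sub>0 nat"
type_synonym ('v, 'c) mpoly = "'v monomial \<Rightarrow>\<^sub>0 'c"

definition mVar :: "'v \<Rightarrow> ('v, 'c::comm_ring_1) mpoly" where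
  "mVar v = Poly_Mapping.single (Poly_Mapping.single v 1) 1"

definition mConst :: "'c::comm_ring_1 \<Rightarrow> ('v, 'c) mpoly" where
  "mConst c = Poly_Mapping.single 0 c"

text \<open>Evaluation at \<open>x\<close>, with coefficients mapped to the target ring by \<open>h\<close>.\<close>

definition mp_eval ::
  "('c::comm_ring_1 \<Rightarrow> 'r::comm_ring_1) \<Rightarrow> ('v \<Rightarrow> 'r) \<Rightarrow> ('v, 'c) mpoly \<Rightarrow> 'r" where
  "mp_eval h x p =
     (\<Sum>\<alpha>\<in>Poly_Mapping.keys p. h (Poly_Mapping.lookup p \<alpha>) *
        (\<Prod>v\<in>Poly_Mapping.keys \<alpha>. x v ^ Poly_Mapping.lookup \<alpha> v))"

definition monomials_of_degree :: "'v set \<Rightarrow> nat \<Rightarrow> 'v monomial set" where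
  "monomials_of_degree V d =
     {\<alpha>. Poly_Mapping.keys \<alpha> \<subseteq> V \<and>
         (\<Sum>v\<in>Poly_Mapping.keys \<alpha>. Poly_Mapping.lookup \<alpha> v) = d}"

definition is_form :: "'v set \<Rightarrow> nat \<Rightarrow> ('v, 'c::comm_ring_1) mpoly \<Rightarrow> bool" where
  "is_form V d p \<longleftrightarrow> Poly_Mapping.keys p \<subseteq> monomials_of_degree V d"


section \<open>Resultants\<close>

text \<open>
  For a system \<open>(F\<^sub>v)\<close>, \<open>v \<in> V\<close>, of forms of degree \<open>d\<close> in the variables \<open>V\<close>, the resultant is a
  polynomial in indeterminates \<open>u\<^bsub>v,\<alpha>\<^esub>\<close>, where \<open>u\<^bsub>v,\<alpha>\<^esub>\<close> stands for the coefficient of the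
  monomial \<open>\<alpha>\<close> in \<open>F\<^sub>v\<close>.
\<close>

type_synonym ('v, 'c) coeff_poly = "('v \<times> 'v monomial, 'c) mpoly"

definition eval_at_system ::
  "('c::comm_ring_1 \<Rightarrow> 'r::comm_ring_1) \<Rightarrow> ('v, 'c) coeff_poly \<Rightarrow> ('v \<Rightarrow> ('v, 'r) mpoly) \<Rightarrow> 'r" where
  "eval_at_system h R F = mp_eval h (\<lambda>(v, \<alpha>). Poly_Mapping.lookup (F v) \<alpha>) R"

text \<open>
  The usual definition of the multivariate resultant (see Cox, Little, O'Shea, Using Algebraic
  Geometry, Chapter 3, Theorem 2.3): for finite nonempty \<open>V\<close> and \<open>d \<ge> 1\<close> there is exactly one
  polynomial \<open>R\<close> that is irreducible over the complex numbers, vanishes precisely at the systems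
  with a nontrivial common zero, and takes the value \<open>1\<close> at the system \<open>(x\<^sub>v\<^sup>d)\<close>. As equations
  and variables are indexed by the same set, no ordering of \<open>V\<close> is involved.
\<close>

definition is_resultant :: "'v set \<Rightarrow> nat \<Rightarrow> ('v, complex) coeff_poly \<Rightarrow> bool" where
  "is_resultant V d R \<longleftrightarrow>
     (\<forall>t\<in>Poly_Mapping.keys R. Poly_Mapping.keys t \<subseteq> V \<times> monomials_of_degree V d) \<and>
     irreducible R \<and>
     (\<forall>F. (\<forall>v\<in>V. is_form V d (F v)) \<longrightarrow>
        (eval_at_system id R F = 0 \<longleftrightarrow>
         (\<exists>x. (\<exists>v\<in>V. x v \<noteq> 0) \<and> (\<forall>v\<in>V. mp_eval id x (F v) = 0)))) \<and>
     eval_at_system id R (\<lambda>v. mVar v ^ d) = 1"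


section \<open>Spectra of uniform hypergraphs\<close>

text \<open>
  A tensor of order \<open>m\<close> is a function on index lists of length \<open>m\<close>. A list of length \<open>m\<close> whose
  set of entries is an edge of an \<open>m\<close>-uniform hypergraph has distinct entries.
\<close>

definition adjacency_tensor :: "nat \<Rightarrow> 'v hypergraph \<Rightarrow> 'v list \<Rightarrow> complex" where
  "adjacency_tensor m H is = (if set is \<in> edges H then 1 / fact (m - 1) else 0)"

text \<open>
  \<open>(\<A> x\<^sup>m\<^sup>-\<^sup>1)\<^sub>i\<close>, over an arbitrary commutative ring, so that \<open>x\<close> may consist of indeterminates.
\<close>

definition tensor_mult ::
  "'v set \<Rightarrow> nat \<Rightarrow> ('v list \<Rightarrow> 'r::comm_ring_1) \<Rightarrow> ('v \<Rightarrow> 'r) \<Rightarrow> 'v \<Rightarrow> 'r" where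
  "tensor_mult V m a x i =
     (\<Sum>js\<in>{js. set js \<subseteq> V \<and> length js = m - 1}. a (i # js) * (\<Prod>j\<leftarrow>js. x j))"

text \<open>
  The system \<open>\<lambda> x\<^bsup>[m-1]\<^esup> - \<A> x\<^sup>m\<^sup>-\<^sup>1\<close> of forms with coefficients in \<open>\<complex>[\<lambda>]\<close>; the indeterminate
  \<open>\<lambda>\<close> is the univariate polynomial \<open>[:0, 1:]\<close>.
\<close>

definition characteristic_system ::
  "'v set \<Rightarrow> nat \<Rightarrow> ('v list \<Rightarrow> complex) \<Rightarrow> 'v \<Rightarrow> ('v, complex poly) mpoly" where
  "characteristic_system V m a i =
     mConst [:0, 1:] * mVar i ^ (m - 1) - tensor_mult V m (\<lambda>is. mConst [:a is:]) mVar i"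

text \<open>
  Since the resultant is unique, the following two relations determine \<open>p\<close> and \<open>S\<close> uniquely for
  every \<open>m\<close>-uniform hypergraph \<open>H\<close> on a finite nonempty vertex set, where \<open>m \<ge> 2\<close>.
\<close>

definition is_characteristic_poly :: "nat \<Rightarrow> 'v hypergraph \<Rightarrow> complex poly \<Rightarrow> bool" where
  "is_characteristic_poly m H p \<longleftrightarrow>
     (\<exists>R. is_resultant (verts H) (m - 1) R \<and>
          p = eval_at_system (\<lambda>c. [:c:]) R
                (characteristic_system (verts H) m (adjacency_tensor m H)))"

definition is_spectrum :: "nat \<Rightarrow> 'v hypergraph \<Rightarrow> complex multiset \<Rightarrow> bool" where
  "is_spectrum m H S \<longleftrightarrow> (\<exists>p. is_characteristic_poly m H p \<and> S = proots p)"

definition high_ordered_cospectral :: "'a hypergraph \<Rightarrow> 'b hypergraph \<Rightarrow> bool" where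
  "high_ordered_cospectral G1 G2 \<longleftrightarrow>
     (\<forall>m\<ge>2. \<exists>S. is_spectrum m (power_hypergraph m G1) S \<and>
                is_spectrum m (power_hypergraph m G2) S)"

end

theory Submission
  imports Defs
begin

text \<open>
  Already the third powers have different sets of eigenvalues. As a resultant vanishes exactly at
  the systems with a nontrivial zero, the roots of the characteristic polynomial are the
  eigenvalues, and for \<open>k > 0\<close> the number \<open>k\<^sup>2\<close> is an eigenvalue of \<open>G\<^sup>3\<close> iff \<open>k\<^sup>3\<close> is an eigenvalue of
  a signed induced subgraph of \<open>G\<close>. The separating value \<open>b = k\<^sup>3\<close> is the spectral radius of the
  first rooted product without the last vertex of one long leg of this spider.

  Let \<open>V\<^sub>0 = 0\<close>, \<open>V\<^sub>1 = 1\<close>, \<open>V\<^bsub>j+2\<^esub> = b V\<^bsub>j+1\<^esub> - V\<^sub>j\<close>. Then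
  \<open>b V\<^sub>n V\<^bsub>n+1\<^esub> = 2 V\<^bsub>n-1\<^esub> V\<^bsub>n+1\<^esub> + 3 V\<^sub>n\<^sup>2\<close> with \<open>2 \<le> b < 5/2\<close>, so that \<open>d = V\<^bsub>n+1\<^esub> / V\<^sub>n\<close> satisfies
  \<open>3 < d\<^sup>2 < 4\<close>. In the second rooted product, eliminating a path with full support multiplies
  its root by \<open>d\<close> in the eigenvalue equations, and a path with a zero entry replaces \<open>d\<close> by at least
  \<open>V\<^sub>n / V\<^bsub>n-1\<^esub> = d / (d\<^sup>2 - 3)\<close>. On the 4-cycle this leaves only the zero vector: if all paths have full
  support, then \<open>d\<^sup>2\<close> would be \<open>0\<close>, \<open>2\<close> or \<open>4\<close>, and otherwise taking absolute values gives \<open>d\<^sup>2 \<ge> 4\<close>.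
\<close>


section \<open>Roots of the characteristic polynomial\<close>

text \<open>Monomials are encoded by lists because \<open>tensor_mult\<close> sums over index lists;
  different lists may encode the same monomial.\<close>

definition list_monomial :: "'v list \<Rightarrow> 'v monomial" where
  "list_monomial js = (\<Sum>j\<leftarrow>js. Poly_Mapping.single j 1)"

lemma list_monomial_simps [simp]:
  "list_monomial [] = 0"
  "list_monomial (j # js) = Poly_Mapping.single j 1 + list_monomial js"
  by (simp_all add: list_monomial_def)

lemma lookup_list_monomial: "Poly_Mapping.lookup (list_monomial js) v = count_list js v"
  by (induction js) (auto simp: lookup_add lookup_single)

lemma keys_list_monomial: "Poly_Mapping.keys (list_monomial js) = set js"
  by (auto simp: in_keys_iff lookup_list_monomial count_list_0_iff)

lemma prod_list_mVar:
  "(\<Prod>j\<leftarrow>js. mVar j :: ('v, 'c::comm_ring_1) mpoly) =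
     Poly_Mapping.single (list_monomial js) 1"
  by (induction js) (simp_all add: mVar_def mult_single)

lemma mVar_power:
  "(mVar v :: ('v, 'c::comm_ring_1) mpoly) ^ k =
     Poly_Mapping.single (list_monomial (replicate k v)) 1"
  using prod_list_mVar[of "replicate k v"] by (simp add: prod_list_replicate)

lemma prod_powers_list_monomial:
  "(\<Prod>v\<in>set js. (x v :: 'r::comm_ring_1) ^ count_list js v) = (\<Prod>j\<leftarrow>js. x j)"
proof -
  \<comment> \<open>The index set is enlarged to a fixed finite \<open>A\<close>, so that it does
    not change with the list during the induction.\<close>
  have "(\<Prod>v\<in>A. x v ^ count_list js v) = (\<Prod>j\<leftarrow>js. x j)" if "finite A" "set js \<subseteq> A" for A
    using that(2)
  proof (induction js)
    case (Cons a js)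
    have "(\<Prod>v\<in>A. x v ^ count_list (a # js) v) =
        (\<Prod>v\<in>A. (if v = a then x v else 1) * x v ^ count_list js v)"
      by (intro prod.cong) auto
    also have "\<dots> = x a * (\<Prod>j\<leftarrow>js. x j)"
      using Cons that(1) by (simp add: prod.distrib)
    finally show ?case by simp
  qed simp
  then show ?thesis by blast
qed

lemma mp_eval_single:
  "mp_eval id x (Poly_Mapping.single (list_monomial js) c) = c * (\<Prod>j\<leftarrow>js. x j)"
  by (cases "c = 0")
    (simp_all add: mp_eval_def keys_list_monomial lookup_list_monomial prod_powers_list_monomial)

lemma mp_eval_superset:
  assumes "finite A" "Poly_Mapping.keys p \<subseteq> A"
  shows "mp_eval id x p =
    (\<Sum>\<alpha>\<in>A. Poly_Mapping.lookup p \<alpha> * (\<Prod>v\<in>Poly_Mapping.keys \<alpha>. x v ^ Poly_Mapping.lookup \<alpha> v))"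
  unfolding mp_eval_def id_apply using assms
  by (intro sum.mono_neutral_left) (auto simp: in_keys_iff)

lemma mp_eval_diff: "mp_eval id x (p - q) = mp_eval id x p - mp_eval id x q"
proof -
  let ?A = "Poly_Mapping.keys p \<union> Poly_Mapping.keys q"
  have "Poly_Mapping.keys (p - q) \<subseteq> ?A"
    by (auto simp: in_keys_iff lookup_minus)
  then show ?thesis
    by (simp add: mp_eval_superset[of ?A] lookup_minus left_diff_distrib sum_subtractf)
qed

lemma mp_eval_add: "mp_eval id x (p + q) = mp_eval id x p + mp_eval id x q"
proof -
  have "mp_eval id x p = mp_eval id x (p + q) - mp_eval id x q"
    by (simp flip: mp_eval_diff)
  then show ?thesis by simp
qed

lemma mp_eval_zero: "mp_eval h x 0 = 0"
  by (simp add: mp_eval_def)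

lemma mp_eval_sum: "mp_eval id x (\<Sum>i\<in>I. f i) = (\<Sum>i\<in>I. mp_eval id x (f i))"
  by (induction I rule: infinite_finite_induct) (simp_all add: mp_eval_add mp_eval_zero del: id_apply)

lemma is_form_single:
  assumes "set js \<subseteq> V" "length js = d"
  shows "is_form V d (Poly_Mapping.single (list_monomial js) c)"
  using assms
  by (auto simp: is_form_def monomials_of_degree_def keys_list_monomial lookup_list_monomial
      sum_count_set)

lemma is_form_diff: "is_form V d p \<Longrightarrow> is_form V d q \<Longrightarrow> is_form V d (p - q)"
  using keys_diff[of p q] by (auto simp: is_form_def)

lemma is_form_sum: "(\<And>i. i \<in> I \<Longrightarrow> is_form V d (f i)) \<Longrightarrow> is_form V d (\<Sum>i\<in>I. f i)"
proof (induction I rule: infinite_finite_induct)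
  case (insert i I)
  then show ?case
    using keys_add[of "f i" "\<Sum>i\<in>I. f i"] by (auto simp: is_form_def)
qed (auto simp: is_form_def)

section \<open>Specialising the indeterminate of the characteristic system\<close>

definition tensor_system ::
  "'v set \<Rightarrow> nat \<Rightarrow> ('v list \<Rightarrow> complex) \<Rightarrow> complex \<Rightarrow> 'v \<Rightarrow> ('v, complex) mpoly" where
  "tensor_system V m a l i =
     Poly_Mapping.single (list_monomial (replicate (m - 1) i)) l -
     (\<Sum>js\<in>{js. set js \<subseteq> V \<and> length js = m - 1}.
        Poly_Mapping.single (list_monomial js) (a (i # js)))"

text \<open>\<open>tensor_system\<close> is the characteristic system with the number
  \<open>l\<close> substituted for the indeterminate, so the two systems can be compared coefficient
  by coefficient.\<close>

lemma lookup_tensor_system: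
  "Poly_Mapping.lookup (tensor_system V m a l i) \<alpha> =
     poly (Poly_Mapping.lookup (characteristic_system V m a i) \<alpha>) l"
proof -
  have "characteristic_system V m a i =
     Poly_Mapping.single (list_monomial (replicate (m - 1) i)) [:0, 1:] -
     (\<Sum>js\<in>{js. set js \<subseteq> V \<and> length js = m - 1}.
        Poly_Mapping.single (list_monomial js) [:a (i # js):])"
    by (simp add: characteristic_system_def tensor_mult_def mVar_power prod_list_mVar
        mConst_def mult_single)
  then show ?thesis
    by (simp add: tensor_system_def lookup_minus lookup_sum lookup_single when_def poly_sum
        if_distrib[of "\<lambda>p. poly p l"] cong: if_cong)
qed

lemma mp_eval_tensor_system:
  "mp_eval id x (tensor_system V m a l i) = l * x i ^ (m - 1) - tensor_mult V m a x i"
  unfolding tensor_system_def mp_eval_diff mp_eval_sum mp_eval_single tensor_mult_def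
  by (simp add: prod_list_replicate)

lemma is_form_tensor_system: "i \<in> V \<Longrightarrow> is_form V (m - 1) (tensor_system V m a l i)"
  unfolding tensor_system_def by (intro is_form_diff is_form_sum is_form_single) auto

definition tensor_eigenvalue ::
  "'v set \<Rightarrow> nat \<Rightarrow> ('v list \<Rightarrow> complex) \<Rightarrow> complex \<Rightarrow> bool" where
  "tensor_eigenvalue V m a l \<longleftrightarrow>
     (\<exists>x. (\<exists>v\<in>V. x v \<noteq> 0) \<and> (\<forall>v\<in>V. tensor_mult V m a x v = l * x v ^ (m - 1)))"

text \<open>Evaluation at \<open>l\<close> is a ring homomorphism that fixes the constants, so it
  commutes with evaluating a polynomial with complex coefficients.\<close>

lemma poly_mp_eval_const:
  "poly (mp_eval (\<lambda>c. [:c:]) x p) l = mp_eval id (\<lambda>v. poly (x v) l) p"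
  by (simp add: mp_eval_def poly_sum poly_prod)

text \<open>By the specialisation above, p(l) is the resultant of a system of complex forms, and the
  vanishing clause of \<open>is_resultant\<close> applies to that system.\<close>

lemma poly_characteristic_poly_eq_0_iff:
  assumes "is_characteristic_poly m H p"
  shows "poly p l = 0 \<longleftrightarrow> tensor_eigenvalue (verts H) m (adjacency_tensor m H) l"
proof -
  let ?a = "adjacency_tensor m H"
  obtain R where R: "is_resultant (verts H) (m - 1) R"
    and p: "p = eval_at_system (\<lambda>c. [:c:]) R (characteristic_system (verts H) m ?a)"
    using assms by (auto simp: is_characteristic_poly_def)
  have "poly p l = eval_at_system id R (tensor_system (verts H) m ?a l)"
    by (simp add: p eval_at_system_def poly_mp_eval_const lookup_tensor_system case_prod_unfold)
  then have "poly p l = 0 \<longleftrightarrow> (\<exists>x. (\<exists>v\<in>verts H. x v \<noteq> 0) \<and>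
      (\<forall>v\<in>verts H. mp_eval id x (tensor_system (verts H) m ?a l v) = 0))"
    using R is_form_tensor_system[of _ "verts H" m ?a l] by (simp add: is_resultant_def)
  then show ?thesis
    unfolding tensor_eigenvalue_def mp_eval_tensor_system right_minus_eq
    by (simp only: eq_commute[of "l * _"])
qed

text \<open>This makes the characteristic polynomial nonzero; only then does membership in
  \<open>proots p\<close> mean being a root. At a coordinate of maximal modulus, the tensor side is
  bounded by the sum of the absolute values of all entries, which \<open>C\<close> exceeds by
  1.\<close>

lemma exists_not_tensor_eigenvalue:
  assumes "finite V"
  shows "\<exists>l. \<not> tensor_eigenvalue V m a l"
proof -
  define J where "J = {js. set js \<subseteq> V \<and> length js = m - 1}"
  define C where "C = (\<Sum>v\<in>V. \<Sum>js\<in>J. norm (a (v # js))) + 1"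
  have C: "C > 0"
    by (auto simp: C_def intro!: sum_nonneg add_nonneg_pos)
  have "\<not> tensor_eigenvalue V m a (of_real C)"
  proof
    assume "tensor_eigenvalue V m a (of_real C)"
    then obtain x u where x: "u \<in> V" "x u \<noteq> 0"
      and eq: "\<And>v. v \<in> V \<Longrightarrow> tensor_mult V m a x v = of_real C * x v ^ (m - 1)"
      by (auto simp: tensor_eigenvalue_def)
    have "Max ((\<lambda>v. norm (x v)) ` V) \<in> (\<lambda>v. norm (x v)) ` V"
      using assms x by (intro Max_in) auto
    then obtain w where w1: "w \<in> V" and "Max ((\<lambda>v. norm (x v)) ` V) = norm (x w)"
      by blast
    then have w: "norm (x v) \<le> norm (x w)" if "v \<in> V" for v
      using Max_ge[of "(\<lambda>v. norm (x v)) ` V" "norm (x v)"] assms that by simp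
    have pos: "norm (x w) > 0"
      using x w[of u] by auto
    have le: "norm (\<Prod>j\<leftarrow>js. x j) \<le> norm (x w) ^ length js" if "set js \<subseteq> V" for js
      using that by (induction js) (auto simp: norm_mult intro!: mult_mono w)
    have "norm (a (w # js) * (\<Prod>j\<leftarrow>js. x j)) \<le> norm (a (w # js)) * norm (x w) ^ (m - 1)"
      if "js \<in> J" for js
      using le[of js] that by (simp add: J_def norm_mult mult_left_mono)
    then have "norm (tensor_mult V m a x w) \<le> (\<Sum>js\<in>J. norm (a (w # js)) * norm (x w) ^ (m - 1))"
      unfolding tensor_mult_def J_def[symmetric] by (rule sum_norm_le)
    also have "\<dots> = (\<Sum>js\<in>J. norm (a (w # js))) * norm (x w) ^ (m - 1)"
      by (simp add: sum_distrib_right)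
    also have "\<dots> < C * norm (x w) ^ (m - 1)"
    proof -
      have "(\<Sum>js\<in>J. norm (a (w # js))) \<le> (\<Sum>v\<in>V. \<Sum>js\<in>J. norm (a (v # js)))"
        using assms w1 by (intro member_le_sum) (auto intro: sum_nonneg)
      then show ?thesis using pos by (simp add: C_def)
    qed
    finally show False
      using eq[OF w1] C by (simp add: norm_mult norm_power)
  qed
  then show ?thesis by blast
qed

lemma spectrum_iff_tensor_eigenvalue:
  assumes "is_spectrum m H S" "finite (verts H)"
  shows "l \<in># S \<longleftrightarrow> tensor_eigenvalue (verts H) m (adjacency_tensor m H) l"
proof -
  obtain p where p: "is_characteristic_poly m H p" "S = proots p"
    using assms(1) by (auto simp: is_spectrum_def)
  have "p \<noteq> 0"
    using exists_not_tensor_eigenvalue[OF assms(2)] poly_characteristic_poly_eq_0_iff[OF p(1)]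
    by (metis poly_0)
  then show ?thesis
    using p poly_characteristic_poly_eq_0_iff[OF p(1)] by simp
qed


section \<open>Eigenvalues of the third power of a graph\<close>

definition simple_graph :: "'a hypergraph \<Rightarrow> bool" where
  "simple_graph G \<longleftrightarrow> finite (verts G) \<and> (\<forall>e\<in>edges G. e \<subseteq> verts G \<and> card e = 2)"

definition nbrs :: "'a hypergraph \<Rightarrow> 'a \<Rightarrow> 'a set" where
  "nbrs G v = {u. {u, v} \<in> edges G}"

lemma
  assumes "simple_graph G"
  shows finite_nbrs: "finite (nbrs G v)"
    and not_in_nbrs: "v \<notin> nbrs G v"
    and edgeE: "e \<in> edges G \<Longrightarrow> v \<in> e \<Longrightarrow> (\<And>u. e = {u, v} \<Longrightarrow> u \<noteq> v \<Longrightarrow> P) \<Longrightarrow> P"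
proof -
  have "nbrs G v \<subseteq> verts G"
    using assms by (auto simp: simple_graph_def nbrs_def)
  then show "finite (nbrs G v)"
    using assms finite_subset by (auto simp: simple_graph_def)
  show "v \<notin> nbrs G v"
    using assms by (auto simp: simple_graph_def nbrs_def)
  show P if "e \<in> edges G" "v \<in> e" "\<And>u. e = {u, v} \<Longrightarrow> u \<noteq> v \<Longrightarrow> P"
  proof -
    from assms that(1) have "card e = 2" by (simp add: simple_graph_def)
    then obtain a b where "e = {a, b}" "a \<noteq> b" by (auto simp: card_2_iff)
    with that(2,3) show P by (metis insert_commute insertE singletonD)
  qed
qed

text \<open>Every edge through \<open>i\<close> is counted by two lists, one for each order of its
  other vertices \<open>f u\<close> and \<open>g u\<close>. The weight 1/2! of a tensor entry
  cancels this factor.\<close>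

lemma tensor_mult_3_eq_sum:
  assumes "finite N" and "inj_on f N" and "\<And>u v. u \<in> N \<Longrightarrow> v \<in> N \<Longrightarrow> f u \<noteq> g v"
    and "finite (verts H)"
    and pairs: "\<And>j k. j \<in> verts H \<and> k \<in> verts H \<and> {i, j, k} \<in> edges H \<longleftrightarrow>
      (\<exists>u\<in>N. (j = f u \<and> k = g u) \<or> (j = g u \<and> k = f u))"
  shows "tensor_mult (verts H) 3 (adjacency_tensor 3 H) x i = (\<Sum>u\<in>N. x (f u) * x (g u))"
proof -
  let ?L = "{js. set js \<subseteq> verts H \<and> length js = 3 - 1}"
  let ?A = "(\<lambda>u. [f u, g u]) ` N" and ?B = "(\<lambda>u. [g u, f u]) ` N"
  let ?t = "\<lambda>js. adjacency_tensor 3 H (i # js) * (\<Prod>j\<leftarrow>js. x j)"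
  have edge: "set (i # js) \<in> edges H \<and> js \<in> ?L \<longleftrightarrow> js \<in> ?A \<union> ?B" for js
  proof (cases "length js = 2")
    case True
    then obtain j k where "js = [j, k]"
      by (metis (no_types, opaque_lifting) One_nat_def Suc_1 length_0_conv length_Suc_conv)
    then show ?thesis using pairs[of j k] by auto
  qed auto
  have "tensor_mult (verts H) 3 (adjacency_tensor 3 H) x i = sum ?t (?A \<union> ?B)"
    unfolding tensor_mult_def
  proof (rule sum.mono_neutral_right)
    show "finite ?L"
      using \<open>finite (verts H)\<close> by (rule finite_lists_length_eq)
    show "?A \<union> ?B \<subseteq> ?L" using edge by blast
    show "\<forall>js\<in>?L - (?A \<union> ?B). ?t js = 0"
      using edge by (auto simp: adjacency_tensor_def)
  qed
  also have "\<dots> = sum ?t ?A + sum ?t ?B"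
    using assms(1,3) by (intro sum.union_disjoint) auto
  also have "sum ?t ?A = (\<Sum>u\<in>N. ?t [f u, g u])"
    using assms(2) by (subst sum.reindex) (auto simp: inj_on_def)
  also have "sum ?t ?B = (\<Sum>u\<in>N. ?t [g u, f u])"
    using assms(2) by (subst sum.reindex) (auto simp: inj_on_def)
  also have "(\<Sum>u\<in>N. ?t [f u, g u]) + (\<Sum>u\<in>N. ?t [g u, f u]) =
      (\<Sum>u\<in>N. ?t [f u, g u] + ?t [g u, f u])"
    by (simp only: sum.distrib)
  also have "\<dots> = (\<Sum>u\<in>N. x (f u) * x (g u))"
  proof (rule sum.cong[OF refl])
    fix u assume "u \<in> N"
    then have "set (i # [f u, g u]) \<in> edges H" "set (i # [g u, f u]) \<in> edges H"
      using edge[of "[f u, g u]"] edge[of "[g u, f u]"] by blast+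
    then show "?t [f u, g u] + ?t [g u, f u] = x (f u) * x (g u)"
      by (simp add: adjacency_tensor_def fact_numeral)
  qed
  finally show ?thesis .
qed

lemma insert_doubleton_eqD:
  assumes "{a, b, c} = {a, p, q}" "a \<noteq> p" "a \<noteq> q" "p \<noteq> q"
  shows "b = p \<and> c = q \<or> b = q \<and> c = p"
proof -
  have "p \<in> {a, b, c}" "q \<in> {a, b, c}"
    unfolding assms(1) by simp_all
  then show ?thesis using assms(2-) by auto
qed

lemma verts_cube: "verts (power_hypergraph 3 G) = Inl ` verts G \<union> (\<lambda>e. Inr (e, 1)) ` edges G"
  by (auto simp: power_hypergraph_def)

lemma edges_cube: "edges (power_hypergraph 3 G) = {insert (Inr (e, 1)) (Inl ` e) |e. e \<in> edges G}"
  by (auto simp: power_hypergraph_def)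

lemma finite_edges: "simple_graph G \<Longrightarrow> finite (edges G)"
  by (rule finite_subset[of _ "Pow (verts G)"]) (auto simp: simple_graph_def)

lemma finite_verts_cube: "simple_graph G \<Longrightarrow> finite (verts (power_hypergraph 3 G))"
  by (simp add: verts_cube finite_edges) (simp add: simple_graph_def)

lemma tensor_mult_cube_vertex:
  fixes G :: "'a hypergraph" and x :: "'a + 'a set \<times> nat \<Rightarrow> complex"
  assumes G: "simple_graph G"
  defines "H \<equiv> power_hypergraph 3 G"
  shows "tensor_mult (verts H) 3 (adjacency_tensor 3 H) x (Inl v) =
    (\<Sum>u\<in>nbrs G v. x (Inl u) * x (Inr ({u, v}, 1)))"
proof (rule tensor_mult_3_eq_sum)
  show "finite (verts H)"
    using finite_verts_cube[OF G] by (simp add: H_def)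
  show "j \<in> verts H \<and> k \<in> verts H \<and> {Inl v, j, k} \<in> edges H \<longleftrightarrow>
    (\<exists>u\<in>nbrs G v. j = Inl u \<and> k = Inr ({u, v}, 1) \<or> j = Inr ({u, v}, 1) \<and> k = Inl u)" for j k
  proof
    assume "j \<in> verts H \<and> k \<in> verts H \<and> {Inl v, j, k} \<in> edges H"
    then obtain e where e: "e \<in> edges G" "{Inl v, j, k} = insert (Inr (e, 1)) (Inl ` e)"
      by (auto simp: H_def edges_cube)
    have "v \<in> e"
      using insertI1[of "Inl v" "{j, k}", unfolded e(2)] by auto
    with edgeE[OF G e(1)] obtain u where u: "e = {u, v}" "u \<noteq> v" by metis
    with e have "{Inl v, j, k} = {Inl v, Inl u, Inr (e, 1)}" by auto
    then have "j = Inl u \<and> k = Inr (e, 1) \<or> j = Inr (e, 1) \<and> k = Inl u"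
      by (rule insert_doubleton_eqD) (use u(2) in auto)
    then show "\<exists>u\<in>nbrs G v. j = Inl u \<and> k = Inr ({u, v}, 1) \<or> j = Inr ({u, v}, 1) \<and> k = Inl u"
      using u e(1) by (auto simp: nbrs_def)
  next
    assume "\<exists>u\<in>nbrs G v. j = Inl u \<and> k = Inr ({u, v}, 1) \<or> j = Inr ({u, v}, 1) \<and> k = Inl u"
    then obtain u where "u \<in> nbrs G v"
      and jk: "j = Inl u \<and> k = Inr ({u, v}, 1) \<or> j = Inr ({u, v}, 1) \<and> k = Inl u"
      by blast
    then have u: "{u, v} \<in> edges G" "{j, k} = {Inl u, Inr ({u, v}, 1)}"
      by (simp add: nbrs_def) (use jk in blast)
    have "u \<in> verts G" "v \<in> verts G"
      using u(1) G by (auto simp: simple_graph_def)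
    then have "{j, k} \<subseteq> verts H"
      unfolding u(2) using u(1) by (auto simp: H_def verts_cube)
    moreover have "{Inl v, j, k} \<in> edges H"
      unfolding H_def edges_cube u(2) using u(1) by (intro CollectI exI[of _ "{u, v}"]) auto
    ultimately show "j \<in> verts H \<and> k \<in> verts H \<and> {Inl v, j, k} \<in> edges H" by simp
  qed
qed (use finite_nbrs[OF G] in \<open>auto simp: inj_on_def\<close>)

lemma tensor_mult_cube_edge:
  fixes G :: "'a hypergraph" and x :: "'a + 'a set \<times> nat \<Rightarrow> complex"
  assumes G: "simple_graph G" and uv: "{u, v} \<in> edges G"
  defines "H \<equiv> power_hypergraph 3 G"
  shows "tensor_mult (verts H) 3 (adjacency_tensor 3 H) x (Inr ({u, v}, 1)) = x (Inl u) * x (Inl v)"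
proof -
  have "u \<noteq> v" "u \<in> verts G" "v \<in> verts G"
    using G uv by (auto simp: simple_graph_def)
  have "tensor_mult (verts H) 3 (adjacency_tensor 3 H) x (Inr ({u, v}, 1)) =
      (\<Sum>_\<in>{()}. x (Inl u) * x (Inl v))"
  proof (rule tensor_mult_3_eq_sum)
    show "finite (verts H)"
      using finite_verts_cube[OF G] by (simp add: H_def)
    show "j \<in> verts H \<and> k \<in> verts H \<and> {Inr ({u, v}, 1), j, k} \<in> edges H \<longleftrightarrow>
      (\<exists>_\<in>{()}. j = Inl u \<and> k = Inl v \<or> j = Inl v \<and> k = Inl u)" for j k
    proof
      assume "j \<in> verts H \<and> k \<in> verts H \<and> {Inr ({u, v}, 1), j, k} \<in> edges H"
      then obtain e where e: "e \<in> edges G"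
        "{Inr ({u, v}, 1), j, k} = insert (Inr (e, 1)) (Inl ` e)"
        by (auto simp: H_def edges_cube)
      have "e = {u, v}"
        using insertI1[of "Inr ({u, v}, 1)" "{j, k}", unfolded e(2)] by auto
      with e have "{Inr ({u, v}, 1), j, k} = {Inr ({u, v}, 1), Inl u, Inl v}" by auto
      then have "j = Inl u \<and> k = Inl v \<or> j = Inl v \<and> k = Inl u"
        by (rule insert_doubleton_eqD) (use \<open>u \<noteq> v\<close> in auto)
      then show "\<exists>_\<in>{()}. j = Inl u \<and> k = Inl v \<or> j = Inl v \<and> k = Inl u" by simp
    next
      assume "\<exists>_\<in>{()}. j = Inl u \<and> k = Inl v \<or> j = Inl v \<and> k = Inl u"
      then have *: "{j, k} = {Inl u, Inl v}" by auto
      have "{j, k} \<subseteq> verts H"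
        unfolding * using \<open>u \<in> verts G\<close> \<open>v \<in> verts G\<close> by (auto simp: H_def verts_cube)
      moreover have "{Inr ({u, v}, 1), j, k} \<in> edges H"
        unfolding H_def edges_cube * using uv by (intro CollectI exI[of _ "{u, v}"]) auto
      ultimately show "j \<in> verts H \<and> k \<in> verts H \<and> {Inr ({u, v}, 1), j, k} \<in> edges H" by simp
    qed
  qed (use \<open>u \<noteq> v\<close> in auto)
  then show ?thesis by simp
qed

section \<open>Eigenvalues of the cube and eigenvectors of signed induced subgraphs\<close>

text \<open>
  For the weight \<open>w\<close> of the new vertex of \<open>{u, v}\<close> the eigenvalue equation reads \<open>k\<^sup>2 w\<^sup>2 = x\<^sub>u x\<^sub>v\<close>.
  If \<open>y\<^sub>v\<close> is a square root of \<open>x\<^sub>v\<^sup>3\<close>, this determines \<open>k x\<^sub>u x\<^sub>v w\<close> as \<open>y\<^sub>u y\<^sub>v\<close> up to sign. The vertices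
  with \<open>y\<^sub>v \<noteq> 0\<close> thus carry an eigenvector of a signed induced subgraph, for the eigenvalue \<open>k\<^sup>3\<close>.
\<close>

lemma tensor_eigenvalue_cube_imp:
  fixes G :: "'a hypergraph" and k :: real
  assumes G: "simple_graph G" and k: "k > 0"
    and ev: "tensor_eigenvalue (verts (power_hypergraph 3 G)) 3
      (adjacency_tensor 3 (power_hypergraph 3 G)) (of_real (k\<^sup>2))"
  obtains y :: "'a \<Rightarrow> complex" and \<epsilon> :: "'a set \<Rightarrow> complex"
  where "\<exists>v\<in>verts G. y v \<noteq> 0" and "\<And>e. \<epsilon> e = 1 \<or> \<epsilon> e = -1"
    and "\<And>v. v \<in> verts G \<Longrightarrow> y v \<noteq> 0 \<Longrightarrow>
      of_real (k ^ 3) * y v = (\<Sum>u\<in>nbrs G v. \<epsilon> {u, v} * y u)"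
proof -
  let ?H = "power_hypergraph 3 G"
  obtain x where nz: "\<exists>i\<in>verts ?H. x i \<noteq> 0"
    and eq: "\<And>i. i \<in> verts ?H \<Longrightarrow>
      tensor_mult (verts ?H) 3 (adjacency_tensor 3 ?H) x i = of_real (k\<^sup>2) * x i ^ (3 - 1)"
    using ev by (auto simp: tensor_eigenvalue_def)
  define X where "X v = x (Inl v)" for v
  define w where "w e = x (Inr (e, 1))" for e
  define y where "y v = csqrt (X v ^ 3)" for v
  have y2: "y v * y v = X v ^ 3" for v
    unfolding y_def by (simp flip: power2_eq_square)
  have y0: "y v = 0 \<longleftrightarrow> X v = 0" for v
    by (simp add: y_def)
  have veq: "of_real (k\<^sup>2) * X v ^ 2 = (\<Sum>u\<in>nbrs G v. X u * w {u, v})" if "v \<in> verts G" for v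
  proof -
    have "Inl v \<in> verts ?H" using that by (simp add: verts_cube)
    from eq[OF this] show ?thesis
      by (simp add: tensor_mult_cube_vertex[OF G] X_def w_def)
  qed
  have eeq: "of_real (k\<^sup>2) * w {u, v} ^ 2 = X u * X v" if "{u, v} \<in> edges G" for u v
  proof -
    have "Inr ({u, v}, 1) \<in> verts ?H" using that by (simp add: verts_cube)
    from eq[OF this] tensor_mult_cube_edge[OF G that, of x] show ?thesis
      by (simp add: X_def w_def)
  qed
  \<comment> \<open>The condition ranges over both orders of the ends of \<open>e\<close>, so that
    the sign belongs to the unordered edge.\<close>
  define sgn_ok where "sgn_ok e s \<longleftrightarrow> (s = 1 \<or> s = -1) \<and>
      (\<forall>u v. e = {u, v} \<longrightarrow> of_real k * (X u * X v * w e) = s * (y u * y v))" for e and s :: complex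
  have ex: "\<exists>s. sgn_ok e s" if e: "e \<in> edges G" for e
  proof -
    from G e obtain a b where ab: "e = {a, b}"
      by (auto simp: simple_graph_def card_2_iff)
    have "(of_real k * (X a * X b * w e))\<^sup>2 = (X a * X b)\<^sup>2 * (of_real (k\<^sup>2) * w e ^ 2)"
      by (simp add: power_mult_distrib)
    also have "\<dots> = (X a * X b)\<^sup>2 * (X a * X b)"
      using eeq[of a b] e ab by simp
    also have "\<dots> = X a ^ 3 * X b ^ 3"
      by (simp add: power2_eq_square power3_eq_cube mult_ac)
    also have "\<dots> = (y a * y b)\<^sup>2"
      by (simp only: y2[symmetric] power2_eq_square mult_ac)
    finally have "of_real k * (X a * X b * w e) = y a * y b \<or>
        of_real k * (X a * X b * w e) = - (y a * y b)"
      by (simp only: power2_eq_iff)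
    then obtain s where "s = 1 \<or> s = -1" "of_real k * (X a * X b * w e) = s * (y a * y b)"
      by (metis mult_1 mult_minus1)
    then have "sgn_ok e s"
      unfolding sgn_ok_def by (auto simp: ab doubleton_eq_iff mult_ac)
    then show ?thesis ..
  qed
  \<comment> \<open>The default 1 off the edges makes \<epsilon> a sign everywhere.\<close>
  define \<epsilon> where "\<epsilon> e = (if e \<in> edges G then SOME s. sgn_ok e s else 1)" for e
  have \<epsilon>: "sgn_ok e (\<epsilon> e)" if "e \<in> edges G" for e
    using someI_ex[OF ex[OF that]] that by (simp add: \<epsilon>_def)
  show thesis
  proof
    show "\<epsilon> e = 1 \<or> \<epsilon> e = -1" for e
      using \<epsilon>[of e] by (cases "e \<in> edges G") (auto simp: sgn_ok_def \<epsilon>_def)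
    show "\<exists>v\<in>verts G. y v \<noteq> 0"
    \<comment> \<open>If all \<open>X v\<close> vanish, the edge equations force the weights of the
      new vertices to vanish too, contradicting the choice of \<open>x\<close>.\<close>
    proof (rule ccontr)
      assume "\<not> ?thesis"
      then have X: "X v = 0" if "v \<in> verts G" for v
        using y0 that by blast
      have "w e = 0" if e: "e \<in> edges G" for e
      proof -
        from G e obtain a b where "e = {a, b}" "a \<in> verts G"
          by (auto simp: simple_graph_def card_2_iff)
        with eeq[of a b] e X k show ?thesis by simp
      qed
      with X nz show False
        by (auto simp: verts_cube X_def w_def)
    qed
    show "of_real (k ^ 3) * y v = (\<Sum>u\<in>nbrs G v. \<epsilon> {u, v} * y u)"
      if v: "v \<in> verts G" "y v \<noteq> 0" for v
    proof -
      \<comment> \<open>The vertex equation is multiplied by \<open>k * X v\<close>, which turns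
        each summand into a signed product of two values of \<open>y\<close>; the nonzero factor
        \<open>y v\<close> is cancelled at the end.\<close>
      have "of_real (k ^ 3) * y v * y v = of_real k * X v * (of_real (k\<^sup>2) * X v ^ 2)"
        using y2[of v] by (simp add: power2_eq_square power3_eq_cube mult_ac)
      also have "\<dots> = (\<Sum>u\<in>nbrs G v. of_real k * (X u * X v * w {u, v}))"
        unfolding veq[OF v(1)] by (simp add: sum_distrib_left mult_ac)
      also have "\<dots> = (\<Sum>u\<in>nbrs G v. \<epsilon> {u, v} * (y u * y v))"
        using \<epsilon> by (intro sum.cong) (auto simp: sgn_ok_def nbrs_def)
      also have "\<dots> = (\<Sum>u\<in>nbrs G v. \<epsilon> {u, v} * y u) * y v"
        by (simp add: sum_distrib_right mult.assoc)
      finally show ?thesis using v(2) by simp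
    qed
  qed
qed

text \<open>The converse direction with all signs equal to 1. With z the real cube root of y, the
  weights z_v^2 on vertices and z_u z_v / k on new vertices solve the equations of the cube.\<close>

lemma tensor_eigenvalue_cube_intro:
  fixes G :: "'a hypergraph" and k :: real and y :: "'a \<Rightarrow> real"
  assumes G: "simple_graph G" and k: "k > 0"
    and nz: "\<exists>v\<in>verts G. y v \<noteq> 0"
    and y: "\<And>v. v \<in> verts G \<Longrightarrow> y v \<noteq> 0 \<Longrightarrow> k ^ 3 * y v = (\<Sum>u\<in>nbrs G v. y u)"
  shows "tensor_eigenvalue (verts (power_hypergraph 3 G)) 3
      (adjacency_tensor 3 (power_hypergraph 3 G)) (of_real (k\<^sup>2))"
proof -
  let ?H = "power_hypergraph 3 G"
  define z where "z v = root 3 (y v)" for v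
  have z3: "z v ^ 3 = y v" for v
    by (simp add: z_def odd_real_root_pow)
  define x :: "'a + 'a set \<times> nat \<Rightarrow> real" where
    "x i = (case i of Inl v \<Rightarrow> (z v)\<^sup>2 | Inr (e, _) \<Rightarrow> (\<Prod>v\<in>e. z v) / k)" for i
  have edge: "x (Inr ({u, v}, 1)) = z u * z v / k" if "{u, v} \<in> edges G" for u v
  proof -
    have "u \<noteq> v" using that G by (auto simp: simple_graph_def)
    then show ?thesis by (simp add: x_def)
  qed
  have "tensor_mult (verts ?H) 3 (adjacency_tensor 3 ?H) (\<lambda>i. of_real (x i)) i =
      of_real (k\<^sup>2) * of_real (x i) ^ 2" if "i \<in> verts ?H" for i
  proof -
    from that consider (vertex) v where "i = Inl v" "v \<in> verts G"
      | (edge) e where "i = Inr (e, 1)" "e \<in> edges G"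
      by (auto simp: verts_cube)
    then show ?thesis
    proof cases
      case (vertex v)
      have "x (Inl u) * x (Inr ({u, v}, 1)) = y u * (z v / k)" if "u \<in> nbrs G v" for u
      proof -
        from that have uv: "{u, v} \<in> edges G" by (simp add: nbrs_def)
        show ?thesis
          unfolding edge[OF uv] by (simp add: x_def z3[symmetric] power2_eq_square power3_eq_cube)
      qed
      then have "(\<Sum>u\<in>nbrs G v. x (Inl u) * x (Inr ({u, v}, 1))) =
          (\<Sum>u\<in>nbrs G v. y u * (z v / k))"
        by simp
      also have "\<dots> = z v / k * (\<Sum>u\<in>nbrs G v. y u)"
        by (simp add: sum_distrib_left mult.commute)
      also have "\<dots> = z v / k * (k ^ 3 * y v)"
        using y[OF vertex(2)] z3[of v] by (cases "y v = 0") (auto simp: z_def)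
      also have "\<dots> = k\<^sup>2 * (x (Inl v))\<^sup>2"
        using k by (simp add: x_def z3[symmetric] power2_eq_square power3_eq_cube)
      finally show ?thesis
        unfolding vertex(1) tensor_mult_cube_vertex[OF G]
        by (simp flip: of_real_mult of_real_sum of_real_power)
    next
      case (edge e)
      then obtain u v where e: "e = {u, v}"
        using G by (auto simp: simple_graph_def card_2_iff)
      have "x (Inl u) * x (Inl v) = k\<^sup>2 * (x (Inr ({u, v}, 1)))\<^sup>2"
        using k edge(2) \<open>\<And>v u. {u, v} \<in> edges G \<Longrightarrow> x (Inr ({u, v}, 1)) = z u * z v / k\<close>[of u v]
        unfolding e by (simp add: x_def power_mult_distrib power_divide)
      then show ?thesis
        unfolding edge(1) e using tensor_mult_cube_edge[OF G, of u v] edge(2) e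
        by (simp flip: of_real_mult of_real_power)
    qed
  qed
  moreover obtain v where "v \<in> verts G" "y v \<noteq> 0"
    using nz by blast
  then have "x (Inl v) \<noteq> 0" "Inl v \<in> verts ?H"
    by (auto simp: x_def z_def verts_cube)
  ultimately show ?thesis
    unfolding tensor_eigenvalue_def by (intro exI[of _ "\<lambda>i. of_real (x i)"]) force
qed


section \<open>Rooted products with paths\<close>

lemma simple_graph_path_graph: "simple_graph (path_graph n)"
  by (auto simp: simple_graph_def path_graph_def)

lemma simple_graph_star_graph: "simple_graph (star_graph k)"
  by (auto simp: simple_graph_def star_graph_def)

lemma edges_cycle_graph_4: "edges (cycle_graph 4) = {{0, 1}, {1, 2}, {2, 3}, {3, 0}}"
proof -
  have "{..<4} = {0, 1, 2, 3::nat}" by auto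
  moreover have "edges (cycle_graph 4) = (\<lambda>i. {i, Suc i mod 4}) ` {..<4}"
    by (auto simp: cycle_graph_def)
  ultimately show ?thesis by simp (simp add: numeral_2_eq_2)
qed

lemma simple_graph_cycle_graph_4: "simple_graph (cycle_graph 4)"
  unfolding simple_graph_def edges_cycle_graph_4 by (auto simp: cycle_graph_def)

lemma simple_graph_complete_graph: "simple_graph (complete_graph k)"
  by (auto simp: simple_graph_def complete_graph_def)

lemma simple_graph_disjoint_union:
  "simple_graph G \<Longrightarrow> simple_graph H \<Longrightarrow> simple_graph (disjoint_union G H)"
  by (auto simp: simple_graph_def disjoint_union_def card_image) blast+

lemma simple_graph_rooted_product:
  "simple_graph G \<Longrightarrow> simple_graph \<Gamma> \<Longrightarrow> r \<in> verts \<Gamma> \<Longrightarrow> simple_graph (rooted_product G \<Gamma> r)"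
  by (auto simp: simple_graph_def rooted_product_def card_image inj_on_def)

lemma nbrs_disjoint_union:
  "nbrs (disjoint_union G H) (Inl v) = Inl ` nbrs G v"
  "nbrs (disjoint_union G H) (Inr w) = Inr ` nbrs H w"
proof -
  have *: "{u, Inl v} = Inl ` e \<longleftrightarrow> (\<exists>a. u = Inl a \<and> e = {a, v})"
    "{u', Inr w} = Inr ` f \<longleftrightarrow> (\<exists>a. u' = Inr a \<and> f = {a, w})"
    "{u, Inl v} \<noteq> Inr ` f" "{u', Inr w} \<noteq> Inl ` e"
    for u u' :: "'a + 'b" and e :: "'a set" and f :: "'b set"
  proof -
    show "{u, Inl v} \<noteq> Inr ` f" "{u', Inr w} \<noteq> Inl ` e"
      by (metis Inl_Inr_False imageE insertCI)+
    show "{u, Inl v} = Inl ` e \<longleftrightarrow> (\<exists>a. u = Inl a \<and> e = {a, v})"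
    proof
      assume *: "{u, Inl v} = Inl ` e"
      then obtain a where a: "u = Inl a" by blast
      then have "Inl ` {a, v} = (Inl ` e :: ('a + 'b) set)" using * by simp
      then have "e = {a, v}" by (metis inj_Inl inj_image_eq_iff)
      with a show "\<exists>a. u = Inl a \<and> e = {a, v}" by blast
    qed auto
    show "{u', Inr w} = Inr ` f \<longleftrightarrow> (\<exists>a. u' = Inr a \<and> f = {a, w})"
    proof
      assume *: "{u', Inr w} = Inr ` f"
      then obtain a where a: "u' = Inr a" by blast
      then have "Inr ` {a, w} = (Inr ` f :: ('a + 'b) set)" using * by simp
      then have "f = {a, w}" by (metis inj_Inr inj_image_eq_iff)
      with a show "\<exists>a. u' = Inr a \<and> f = {a, w}" by blast
    qed auto
  qed
  show "nbrs (disjoint_union G H) (Inl v) = Inl ` nbrs G v"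
    "nbrs (disjoint_union G H) (Inr w) = Inr ` nbrs H w"
    by (auto simp: nbrs_def disjoint_union_def image_iff *)
qed

lemma nbrs_rooted_product:
  assumes G: "simple_graph G" and \<Gamma>: "simple_graph \<Gamma>" and v: "v \<in> verts G"
  shows "nbrs (rooted_product G \<Gamma> r) (v, w) =
    Pair v ` nbrs \<Gamma> w \<union> (if w = r then (\<lambda>u. (u, r)) ` nbrs G v else {})" (is "?L = ?R")
proof
  show "?L \<subseteq> ?R"
  proof
    fix x assume "x \<in> ?L"
    then consider (root) e where "e \<in> edges G" "{x, (v, w)} = (\<lambda>v. (v, r)) ` e"
      | (copy) v' f where "f \<in> edges \<Gamma>" "{x, (v, w)} = Pair v' ` f"
      unfolding nbrs_def rooted_product_def by auto
    then show "x \<in> ?R"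
    proof cases
      case root
      have "(v, w) \<in> (\<lambda>v. (v, r)) ` e" unfolding root(2)[symmetric] by simp
      then have "w = r" "v \<in> e" by auto
      from edgeE[OF G root(1) this(2)] obtain u where u: "e = {u, v}" "u \<noteq> v" .
      have "{x, (v, w)} = {(u, r), (v, r)}" using root(2) u(1) by simp
      then have "x = (u, r)" using u(2) \<open>w = r\<close> by (auto simp: doubleton_eq_iff)
      then show ?thesis using u root(1) \<open>w = r\<close> by (auto simp: nbrs_def)
    next
      case copy
      have "(v, w) \<in> Pair v' ` f" unfolding copy(2)[symmetric] by simp
      then have "v' = v" "w \<in> f" by auto
      from edgeE[OF \<Gamma> copy(1) this(2)] obtain u where u: "f = {u, w}" "u \<noteq> w" .
      have "{x, (v, w)} = {(v, u), (v, w)}" using copy(2) u(1) \<open>v' = v\<close> by simp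
      then have "x = (v, u)" using u(2) by (auto simp: doubleton_eq_iff)
      then show ?thesis using u copy(1) by (auto simp: nbrs_def)
    qed
  qed
  show "?R \<subseteq> ?L"
  proof -
    have "{(v, u), (v, w)} \<in> edges (rooted_product G \<Gamma> r)" if "{u, w} \<in> edges \<Gamma>" for u
    proof -
      have "{(v, u), (v, w)} = Pair v ` {u, w}" by simp
      then show ?thesis using that v unfolding rooted_product_def by (auto simp del: image_insert)
    qed
    moreover have "{(u, r), (v, r)} \<in> edges (rooted_product G \<Gamma> r)" if "{u, v} \<in> edges G" for u
    proof -
      have "{(u, r), (v, r)} = (\<lambda>v. (v, r)) ` {u, v}" by simp
      then show ?thesis using that unfolding rooted_product_def by (auto simp del: image_insert)
    qed
    ultimately show ?thesis by (auto simp: nbrs_def)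
  qed
qed

lemma sum_nbrs_rooted_product:
  assumes G: "simple_graph G" and \<Gamma>: "simple_graph \<Gamma>" and v: "v \<in> verts G"
  shows "sum f (nbrs (rooted_product G \<Gamma> r) (v, w)) =
    (\<Sum>u\<in>nbrs \<Gamma> w. f (v, u)) + (if w = r then \<Sum>u\<in>nbrs G v. f (u, r) else 0)"
proof -
  have "sum f (nbrs (rooted_product G \<Gamma> r) (v, w)) =
      sum f (Pair v ` nbrs \<Gamma> w) + sum f (if w = r then (\<lambda>u. (u, r)) ` nbrs G v else {})"
    unfolding nbrs_rooted_product[OF assms]
    using finite_nbrs[OF G] finite_nbrs[OF \<Gamma>] not_in_nbrs[OF G, of v]
    by (intro sum.union_disjoint) (auto split: if_splits)
  then show ?thesis
    by (simp add: sum.reindex inj_on_def)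
qed

section \<open>Neighbourhoods in the star, the 4-cycle and the one-vertex graph\<close>

lemma nbrs_star_graph:
  "nbrs (star_graph k) 0 = {1..k}"
  "i \<in> {1..k} \<Longrightarrow> nbrs (star_graph k) i = {0}"
  by (auto simp: nbrs_def star_graph_def doubleton_eq_iff)

lemma nbrs_cycle_graph_4:
  "nbrs (cycle_graph 4) 0 = {1, 3}" "nbrs (cycle_graph 4) 1 = {0, 2}"
  "nbrs (cycle_graph 4) 2 = {1, 3}" "nbrs (cycle_graph 4) 3 = {0, 2}"
  unfolding nbrs_def edges_cycle_graph_4 by (auto simp: doubleton_eq_iff)

lemma nbrs_complete_graph_1: "nbrs (complete_graph 1) v = {}"
proof -
  have "card e \<noteq> 2" if "e \<subseteq> {..<1::nat}" for e
    using card_mono[OF _ that] by simp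
  then show ?thesis by (auto simp: nbrs_def complete_graph_def)
qed

section \<open>Paths numbered towards the root\<close>

text \<open>
  The vertices of the path are \<open>q 1, \<dots>, q n\<close>, numbered from its far end towards the root \<open>q n\<close>.
\<close>

locale rooted_path =
  fixes n r :: nat and q ht :: "nat \<Rightarrow> nat"
  assumes n: "n \<ge> 2" and q_n: "q n = r"
    and q: "k \<in> {1..n} \<Longrightarrow> q k < n" and ht_q: "k \<in> {1..n} \<Longrightarrow> ht (q k) = k"
    and ht: "w < n \<Longrightarrow> ht w \<in> {1..n}" and q_ht: "w < n \<Longrightarrow> q (ht w) = w"
    and nbrs_q: "k \<in> {1..n} \<Longrightarrow> nbrs (path_graph n) (q k) = q ` ({k - 1, k + 1} \<inter> {1..n})"

lemma nbrs_path_graph: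
  "nbrs (path_graph n) i = {j. i < n \<and> j < n \<and> (j = i + 1 \<or> i = j + 1)}"
  by (auto simp: nbrs_def path_graph_def doubleton_eq_iff)

lemma pendent_vertex_path_graph:
  assumes "pendent_vertex (path_graph n) r"
  shows "r = 0 \<or> Suc r = n"
proof (rule ccontr)
  assume "\<not> ?thesis"
  moreover have "r < n" using assms by (auto simp: pendent_vertex_def path_graph_def)
  ultimately have r: "0 < r" "Suc r < n" by auto
  obtain e where e: "{e \<in> edges (path_graph n). r \<in> e} = {e}"
    using assms by (auto simp: pendent_vertex_def card_1_singleton_iff)
  have *: "{r, Suc r} \<in> edges (path_graph n)" "{r - 1, Suc (r - 1)} \<in> edges (path_graph n)"
    unfolding path_graph_def using r by auto
  have "{r, Suc r} \<in> {e}" "{r - 1, Suc (r - 1)} \<in> {e}"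
    unfolding e[symmetric] using * r by simp_all
  then have "{r, Suc r} = {r - 1, Suc (r - 1)}" by simp
  then show False using r by (simp add: doubleton_eq_iff)
qed

text \<open>An inner vertex of a path lies on two edges, so the root is 0 or n - 1. The numbering
  reverses the path in the first case and shifts it by one in the second; later arguments need not
  distinguish them.\<close>

lemma rooted_path_exists:
  assumes n: "n \<ge> 2" and r: "pendent_vertex (path_graph n) r"
  obtains q ht where "rooted_path n r q ht"
proof (cases "r = 0")
  case True
  have "rooted_path n r (\<lambda>k. n - k) (\<lambda>w. n - w)"
  proof
    show "nbrs (path_graph n) (n - k) = (\<lambda>k. n - k) ` ({k - 1, k + 1} \<inter> {1..n})"
      if "k \<in> {1..n}" for k
    proof (intro set_eqI iffI)
      fix j assume "j \<in> nbrs (path_graph n) (n - k)"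
      then show "j \<in> (\<lambda>k. n - k) ` ({k - 1, k + 1} \<inter> {1..n})"
        using that unfolding nbrs_path_graph by (intro image_eqI[of _ _ "n - j"]) auto
    qed (use that in \<open>auto simp: nbrs_path_graph\<close>)
  qed (use n True in auto)
  then show ?thesis by (rule that)
next
  case False
  then have "Suc r = n" using pendent_vertex_path_graph[OF r] by simp
  have "rooted_path n r (\<lambda>k. k - 1) Suc"
  proof
    show "nbrs (path_graph n) (k - 1) = (\<lambda>k. k - 1) ` ({k - 1, k + 1} \<inter> {1..n})"
      if "k \<in> {1..n}" for k
    proof (intro set_eqI iffI)
      fix j assume "j \<in> nbrs (path_graph n) (k - 1)"
      then show "j \<in> (\<lambda>k. k - 1) ` ({k - 1, k + 1} \<inter> {1..n})"
        using that unfolding nbrs_path_graph by (intro image_eqI[of _ _ "Suc j"]) auto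
    qed (use that in \<open>auto simp: nbrs_path_graph\<close>)
  qed (use n \<open>Suc r = n\<close> in auto)
  then show ?thesis by (rule that)
qed

context rooted_path
begin

lemma sum_nbrs_q:
  fixes f :: "nat \<Rightarrow> 'c::comm_monoid_add"
  assumes k: "k \<in> {1..n}"
  shows "(\<Sum>u\<in>nbrs (path_graph n) (q k). f u) =
    (if 1 < k then f (q (k - 1)) else 0) + (if k < n then f (q (k + 1)) else 0)"
proof -
  have inj: "inj_on q {1..n}" using ht_q by (metis inj_onI)
  have "{k - 1, k + 1} \<inter> {1..n} =
      (if 1 < k then {k - 1} else {}) \<union> (if k < n then {k + 1} else {})"
    using k by auto
  moreover have "(\<Sum>u\<in>nbrs (path_graph n) (q k). f u) = (\<Sum>j\<in>{k - 1, k + 1} \<inter> {1..n}. f (q j))"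
    unfolding nbrs_q[OF k] by (subst sum.reindex) (auto intro: inj_on_subset[OF inj])
  ultimately show ?thesis by (simp add: add.commute)
qed

lemma q_eq_root_iff: "k \<in> {1..n} \<Longrightarrow> q k = r \<longleftrightarrow> k = n"
  using q_n ht_q n by (metis atLeastAtMost_iff order_refl le_trans one_le_numeral)

lemma root_in_path: "r \<in> verts (path_graph n)"
  using q[of n] q_n n by (simp add: path_graph_def)

text \<open>Only the root sees \<open>G\<close>: its neighbour sum in \<open>G\<close> takes the
  place of a value at position n + 1, which gives a three-term recurrence along the whole
  path.\<close>

lemma sum_nbrs_rooted_path:
  assumes G: "simple_graph G" and v: "v \<in> verts G" and k: "k \<in> {1..n}"
  shows "sum f (nbrs (rooted_product G (path_graph n) r) (v, q k)) =
    (if 1 < k then f (v, q (k - 1)) else 0) +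
    (if k < n then f (v, q (k + 1)) else \<Sum>u\<in>nbrs G v. f (u, r))"
  using k by (simp add: sum_nbrs_rooted_product[OF G simple_graph_path_graph v] sum_nbrs_q
      q_eq_root_iff)

lemma verts_rooted_pathE:
  assumes "x \<in> verts (rooted_product G (path_graph n) r)"
  obtains v k where "x = (v, q k)" "v \<in> verts G" "k \<in> {1..n}"
proof -
  obtain v w where "x = (v, w)" "v \<in> verts G" "w < n"
    using assms by (auto simp: rooted_product_def path_graph_def)
  with that[of v "ht w"] show thesis
    using ht q_ht by simp
qed

end


section \<open>The recurrence along a path\<close>

text \<open>For k >= 1 this is the characteristic polynomial of the path on k - 1 vertices,
  evaluated at \<open>b\<close>: a Chebyshev polynomial of the second kind in b/2. Below, V_k stands
  for \<open>path_seq b k\<close>.\<close>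

fun path_seq :: "real \<Rightarrow> nat \<Rightarrow> real" where
  "path_seq b 0 = 0"
| "path_seq b (Suc 0) = 1"
| "path_seq b (Suc (Suc k)) = b * path_seq b (Suc k) - path_seq b k"

lemma path_seq_rec: "1 \<le> k \<Longrightarrow> path_seq b (k + 1) = b * path_seq b k - path_seq b (k - 1)"
  by (cases k) auto

lemma path_seq_mono:
  assumes "b \<ge> 2"
  shows "0 \<le> path_seq b k \<and> path_seq b k < path_seq b (Suc k)"
proof (induction k)
  case (Suc k)
  then have "2 * path_seq b (Suc k) \<le> b * path_seq b (Suc k)"
    using assms by (intro mult_right_mono) auto
  with Suc.IH show ?case unfolding path_seq.simps(3) by linarith
qed simp

lemma path_seq_pos: "b \<ge> 2 \<Longrightarrow> 0 < k \<Longrightarrow> 0 < path_seq b k"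
  using path_seq_mono[of b "k - 1"] by simp

lemma path_seq_2: "path_seq 2 k = real k"
  by (induction "2::real" k rule: path_seq.induct) auto

text \<open>For b = 5/2 the recurrence has characteristic roots 2 and 1/2, and the difference of the
  two sides is 2^(-k).\<close>

lemma path_seq_5_2: "2 * path_seq (5/2) k < path_seq (5/2) (Suc k)"
  by (induction k) auto

section \<open>The choice of the separating value\<close>

lemma continuous_on_path_seq [continuous_intros]: "continuous_on A (\<lambda>b. path_seq b k)"
proof -
  have "continuous_on A (\<lambda>b. path_seq b k) \<and> continuous_on A (\<lambda>b. path_seq b (Suc k))"
    by (induction k) (auto intro!: continuous_intros)
  then show ?thesis ..
qed

text \<open>With m = n - 1 this is the eigenvalue equation at the centre of the spider. The
  difference \<open>F\<close> of its sides is negative at 2, where V_k = k, and positive at 5/2, so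
  the intermediate value theorem applies.\<close>

lemma exists_path_seq_eq:
  assumes "m \<ge> 1"
  obtains b where "2 \<le> b" "b < 5/2"
    "b * path_seq b (Suc m) * path_seq b (Suc (Suc m)) =
       2 * path_seq b m * path_seq b (Suc (Suc m)) + 3 * (path_seq b (Suc m))\<^sup>2"
proof -
  define F where "F b = b * path_seq b (Suc m) * path_seq b (Suc (Suc m)) -
       2 * path_seq b m * path_seq b (Suc (Suc m)) - 3 * (path_seq b (Suc m))\<^sup>2" for b
  have "F 2 = - 3 * (real m)\<^sup>2 - 4 * real m + 1"
    by (simp add: F_def path_seq_2 power2_eq_square algebra_simps del: path_seq.simps)
  also have "\<dots> < 0" using assms by (auto intro: le_less_trans[of _ "1 - 4 * real m"])
  finally have F2: "F 2 < 0" .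
  have F52: "F (5/2) > 0"
  proof -
    let ?u = "path_seq (5/2) m" and ?v = "path_seq (5/2) (Suc m)"
    have "?u < ?v / 2" "0 \<le> ?u" "0 < ?v"
      using path_seq_5_2[of m] path_seq_mono[of "5/2" m] path_seq_pos[of "5/2" "Suc m"] by auto
    \<comment> \<open>The product 3 v^2 of the two lower bounds is exactly the term subtracted in
      \<open>F\<close>.\<close>
    then have "(5/2 * ?v - 2 * ?u) * path_seq (5/2) (Suc (Suc m)) > (3/2 * ?v) * (2 * ?v)"
      using path_seq_5_2[of "Suc m"] by (intro mult_strict_mono) auto
    then show ?thesis
      by (simp add: F_def power2_eq_square algebra_simps del: path_seq.simps)
  qed
  have "\<exists>b\<ge>2. b \<le> 5/2 \<and> F b = 0"
    using F2 F52 unfolding F_def by (intro IVT') (auto intro!: continuous_intros simp del: path_seq.simps)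
  then obtain b where "2 \<le> b" "b \<le> 5/2" "F b = 0" by blast
  moreover from this F52 have "b \<noteq> 5/2" by (metis less_irrefl)
  ultimately show ?thesis using that[of b] by (simp add: F_def)
qed

text \<open>Moduli along a leg grow at least as fast as V_k. The ratio bound is cross-multiplied so
  that zero entries are allowed, and it passes from k to k + 1 by the recurrence for V.\<close>

lemma leg_estimate:
  fixes a :: "nat \<Rightarrow> complex"
  assumes b: "b \<ge> 2" and a0: "a 0 = 0"
    and le: "\<And>k. 1 \<le> k \<Longrightarrow> k \<le> n \<Longrightarrow> b * norm (a k) \<le> norm (a (k - 1)) + norm (a (k + 1))"
    and k: "k \<le> n"
  shows "norm (a k) * path_seq b (Suc k) \<le> norm (a (Suc k)) * path_seq b k"
  using k
proof (induction k)
  case (Suc k)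
  have "b * norm (a (Suc k)) * path_seq b (Suc k) \<le>
      (norm (a k) + norm (a (Suc (Suc k)))) * path_seq b (Suc k)"
    using le[of "Suc k"] Suc.prems path_seq_pos[OF b, of "Suc k"] by (intro mult_right_mono) auto
  with Suc show ?case by (simp add: algebra_simps)
qed (simp add: a0)

text \<open>By the growth estimate, a zero entry forces all entries before it to vanish, so the case
  split is on \<open>a 1\<close>. If it is zero, the leg is effectively shorter by one vertex;
  otherwise all equations hold and the recurrence is solved exactly, up to signs.\<close>

lemma leg_dichotomy:
  fixes a :: "nat \<Rightarrow> complex"
  assumes b: "b \<ge> 2" and a0: "a 0 = 0" and E: "\<And>k. E k = 1 \<or> E k = (-1 :: complex)"
    and eq: "\<And>k. 1 \<le> k \<Longrightarrow> k \<le> n \<Longrightarrow> a k \<noteq> 0 \<Longrightarrow>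
      of_real b * a k = E (k - 1) * a (k - 1) + E k * a (k + 1)"
    and n: "n \<ge> 1"
  shows "\<And>k. k \<le> n \<Longrightarrow> norm (a k) * path_seq b (Suc k) \<le> norm (a (Suc k)) * path_seq b k"
    and "norm (a n) * path_seq b n \<le> norm (a (Suc n)) * path_seq b (n - 1) \<or>
      a n * of_real (path_seq b (Suc n)) = E n * a (Suc n) * of_real (path_seq b n)"
proof -
  have nE: "norm (E k) = 1" for k
    using E[of k] by auto
  have E2: "E k * (E k * z) = z" for k z
    using E[of k] by auto
  have le: "b * norm (a k) \<le> norm (a (k - 1)) + norm (a (k + 1))" if "1 \<le> k" "k \<le> n" for k
  proof (cases "a k = 0")
    case False
    have "b * norm (a k) = norm (of_real b * a k)" using b by (simp add: norm_mult)
    also have "\<dots> \<le> norm (E (k - 1) * a (k - 1)) + norm (E k * a (k + 1))"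
      unfolding eq[OF that False] by (rule norm_triangle_ineq)
    finally show ?thesis by (simp add: norm_mult nE)
  qed simp
  show est: "norm (a k) * path_seq b (Suc k) \<le> norm (a (Suc k)) * path_seq b k"
    if "k \<le> n" for k
    using leg_estimate[OF b a0 le that] by simp
  show "norm (a n) * path_seq b n \<le> norm (a (Suc n)) * path_seq b (n - 1) \<or>
      a n * of_real (path_seq b (Suc n)) = E n * a (Suc n) * of_real (path_seq b n)"
  proof (cases "a 1 = 0")
    case True
    \<comment> \<open>Dropping the zero at position 1 gives a leg with n - 1 positions and the
      better ratio V_n / V_(n-1).\<close>
    define a' where "a' k = a (Suc k)" for k
    have "norm (a' (n - 1)) * path_seq b (Suc (n - 1)) \<le> norm (a' (Suc (n - 1))) * path_seq b (n - 1)"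
    proof (rule leg_estimate[OF b, where n = "n - 1"])
      show "a' 0 = 0" using True by (simp add: a'_def)
      show "b * norm (a' k) \<le> norm (a' (k - 1)) + norm (a' (k + 1))"
        if "1 \<le> k" "k \<le> n - 1" for k
        using le[of "Suc k"] that by (simp add: a'_def)
    qed simp
    then show ?thesis using n by (simp add: a'_def)
  next
    case False
    have nz: "a k \<noteq> 0" if "1 \<le> k" "k \<le> n" for k
      using that
    proof (induction k rule: nat_induct_at_least)
      case (Suc k)
      then have "norm (a k) * path_seq b (Suc k) > 0"
        using path_seq_pos[OF b, of "Suc k"] by simp
      with est[of k] Suc.prems show ?case by auto
    qed (use False in simp)
    have "a k * of_real (path_seq b (Suc k)) = E k * a (Suc k) * of_real (path_seq b k)"
      if "1 \<le> k" "k \<le> n" for k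
      using that
    proof (induction k rule: nat_induct_at_least)
      case base
      then show ?case using eq[of 1] False a0 by (simp add: mult.commute)
    next
      case (Suc k)
      \<comment> \<open>Multiplying by the sign \<open>E k\<close>, which is its own inverse, solves
        the induction hypothesis for the term in the next equation.\<close>
      have "E k * (a k * of_real (path_seq b (Suc k))) = E k * (E k * a (Suc k) * of_real (path_seq b k))"
        using Suc by simp
      then have "E k * a k * of_real (path_seq b (Suc k)) = a (Suc k) * of_real (path_seq b k)"
        using E2[of k "a (Suc k) * of_real (path_seq b k)"] by (simp only: mult.assoc)
      moreover have "of_real b * a (Suc k) = E k * a k + E (Suc k) * a (Suc (Suc k))"
        using eq[of "Suc k"] nz[of "Suc k"] Suc.prems by simp
      then have "of_real b * a (Suc k) * of_real (path_seq b (Suc k)) =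
          (E k * a k + E (Suc k) * a (Suc (Suc k))) * of_real (path_seq b (Suc k))"
        by simp
      ultimately show ?case by (simp add: algebra_simps)
    qed
    then show ?thesis using n by blast
  qed
qed

text \<open>Here p is the modulus at a deficient vertex of the 4-cycle, s that at the opposite one,
  and t, u those at their neighbours. Adding the bounds in pairs gives d^2 (t + u) <= 2 (d^2 - 2) (t
  + u), impossible for t + u > 0 as d^2 < 4.\<close>

lemma cycle_deficient:
  fixes d p s t u :: real
  assumes d: "d > 0" "d\<^sup>2 < 4" and nonneg: "p \<ge> 0" "s \<ge> 0" "t \<ge> 0" "u \<ge> 0"
    and p: "d * p \<le> (d\<^sup>2 - 3) * (t + u)" and s: "d * s \<le> t + u"
    and t: "d * t \<le> p + s" and u: "d * u \<le> p + s"
  shows "p = 0 \<and> s = 0 \<and> t = 0 \<and> u = 0"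
proof -
  have "d * (d * (t + u)) \<le> d * (2 * (p + s))"
    using t u d(1) by (intro mult_left_mono) (auto simp: algebra_simps)
  also have "\<dots> \<le> 2 * (d\<^sup>2 - 2) * (t + u)"
    using p s by (simp add: algebra_simps)
  finally have "(4 - d\<^sup>2) * (t + u) \<le> 0"
    by (simp add: power2_eq_square algebra_simps)
  then have "t + u \<le> 0"
    using d(2) by (simp add: mult_le_0_iff)
  then have tu: "t = 0" "u = 0" using nonneg by auto
  with p s d(1) have "p \<le> 0" "s \<le> 0" by (auto simp: mult_le_0_iff)
  with tu nonneg show ?thesis by simp
qed

text \<open>Two steps on the signed cycle give (d^2 - 2) x0 = c x2 and (d^2 - 2) x2 = c x0, where c
  sums the signs of the two walks between opposite vertices. As c is 0, 2 or -2, a nonzero solution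
  would need d^2 in {0, 2, 4}.\<close>

lemma cycle_exact:
  fixes x0 x1 x2 x3 :: complex
  assumes d: "3 < d\<^sup>2" "d\<^sup>2 < (4::real)"
    and e: "e0 = 1 \<or> e0 = -1" "e1 = 1 \<or> e1 = -1" "e2 = 1 \<or> e2 = -1" "e3 = 1 \<or> e3 = -1"
    and x0: "of_real d * x0 = e0 * x1 + e3 * x3"
    and x1: "of_real d * x1 = e0 * x0 + e1 * x2"
    and x2: "of_real d * x2 = e1 * x1 + e2 * x3"
    and x3: "of_real d * x3 = e2 * x2 + e3 * x0"
  shows "x0 = 0 \<and> x1 = 0 \<and> x2 = 0 \<and> x3 = 0"
proof -
  define D :: complex where "D = of_real (d\<^sup>2 - 2)"
  have D: "D \<noteq> 0" "D \<noteq> 2" "D \<noteq> -2" and d0: "of_real d \<noteq> (0::complex)"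
  proof -
    have "Re D \<noteq> 0" "Re D \<noteq> 2" "Re D \<noteq> -2" using d by (auto simp: D_def)
    then show "D \<noteq> 0" "D \<noteq> 2" "D \<noteq> -2" by auto
    show "of_real d \<noteq> (0::complex)" using d by auto
  qed
  have sq: "e0 * e0 = 1" "e1 * e1 = 1" "e2 * e2 = 1" "e3 * e3 = 1"
    using e by auto
  define c where "c = e0 * e1 + e3 * e2"
  have dd: "of_real d * (of_real d * z) = (D + 2) * z" for z
    by (simp add: D_def power2_eq_square algebra_simps)
  have "(D + 2) * x0 = e0 * (of_real d * x1) + e3 * (of_real d * x3)"
    unfolding dd[symmetric] x0 by (simp add: algebra_simps)
  also have "\<dots> = (e0 * e0 + e3 * e3) * x0 + c * x2"
    unfolding x1 x3 by (simp add: c_def algebra_simps)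
  finally have 0: "D * x0 = c * x2" by (simp add: sq algebra_simps)
  have "(D + 2) * x2 = e1 * (of_real d * x1) + e2 * (of_real d * x3)"
    unfolding dd[symmetric] x2 by (simp add: algebra_simps)
  also have "\<dots> = (e1 * e1 + e2 * e2) * x2 + c * x0"
    unfolding x1 x3 by (simp add: c_def algebra_simps)
  finally have 2: "D * x2 = c * x0" by (simp add: sq algebra_simps)
  have "D * (D * x0) = c * (D * x2)" using 0 by (simp add: algebra_simps)
  also have "\<dots> = c * c * x0" using 2 by (simp add: algebra_simps)
  finally have "(D * D - c * c) * x0 = 0" by (simp add: algebra_simps)
  moreover have "D * D \<noteq> c * c"
  proof -
    have "c = 0 \<or> c = 2 \<or> c = -2" using e by (auto simp: c_def)
    then show ?thesis using D by (auto simp: square_eq_iff)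
  qed
  ultimately have "x0 = 0" by simp
  with 2 D have "x2 = 0" by simp
  with \<open>x0 = 0\<close> x1 x3 d0 show ?thesis by simp
qed


section \<open>The two rooted products\<close>

context rooted_path
begin

text \<open>
  The vector below is supported on the spider with legs of \<open>n - 1, n - 1, n, n, n\<close> vertices, which
  arises from the first rooted product by deleting the last vertex of one of its four long legs.
\<close>

lemma star_eigenvalue:
  fixes b k :: real
  assumes b: "b \<ge> 2"
    and eq: "b * path_seq b n * path_seq b (n + 1) =
      2 * path_seq b (n - 1) * path_seq b (n + 1) + 3 * (path_seq b n)\<^sup>2"
    and k: "k > 0" "k ^ 3 = b"
  defines "H \<equiv> power_hypergraph 3 (rooted_product (star_graph 4) (path_graph n) r)"
  shows "tensor_eigenvalue (verts H) 3 (adjacency_tensor 3 H) (of_real (k\<^sup>2))"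
proof -
  let ?S = "star_graph 4" and ?V = "path_seq b"
  \<comment> \<open>Each leg carries a multiple of V, scaled so that legs 1 to 4 continue at
    position n + 1 to the central value V_n V_(n+1). On leg 4 the index shift puts V_0 = 0 on the
    deleted vertex.\<close>
  define g where "g v j = (if v = 0 then ?V j * ?V (n + 1) else
      if v = 4 then ?V (j - 1) * ?V (n + 1) else ?V j * ?V n)" for v j :: nat
  define y where "y = (\<lambda>(v, w). g v (ht w))"
  have y: "y (v, q j) = g v j" if "j \<in> {1..n}" for v j
    using ht_q[OF that] by (simp add: y_def)
  have yr: "y (v, r) = g v n" for v
    using y[of n v] n q_n by simp
  have rec: "b * ?V j = ?V (j - 1) + ?V (j + 1)" if "1 \<le> j" for j
    using path_seq_rec[OF that, of b] by simp
  have four: "{1..4::nat} = {1, 2, 3, 4}" by auto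
  have verts: "v \<in> verts ?S \<longleftrightarrow> v \<in> {0, 1, 2, 3, 4}" for v
    by (auto simp: star_graph_def)
  show ?thesis
    unfolding H_def
  proof (rule tensor_eigenvalue_cube_intro[where y = y])
    show "simple_graph (rooted_product ?S (path_graph n) r)"
      by (intro simple_graph_rooted_product simple_graph_star_graph simple_graph_path_graph
          root_in_path)
    show "\<exists>x\<in>verts (rooted_product ?S (path_graph n) r). y x \<noteq> 0"
    proof
      show "(0, r) \<in> verts (rooted_product ?S (path_graph n) r)"
        using root_in_path by (simp add: rooted_product_def verts)
      show "y (0, r) \<noteq> 0"
        using path_seq_pos[OF b, of n] path_seq_pos[OF b, of "n + 1"] n by (simp add: yr g_def)
    qed
    show "k ^ 3 * y x = sum y (nbrs (rooted_product ?S (path_graph n) r) x)"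
      if x: "x \<in> verts (rooted_product ?S (path_graph n) r)" and nz: "y x \<noteq> 0" for x
    proof -
      obtain v j where x': "x = (v, q j)" "v \<in> verts ?S" and j: "j \<in> {1..n}"
        using x by (rule verts_rooted_pathE)
      have prev: "y (v, q (j - 1)) = g v (j - 1)" if "1 < j"
        by (rule y) (use that j in auto)
      have sum: "sum y (nbrs (rooted_product ?S (path_graph n) r) x) =
          (if 1 < j then g v (j - 1) else 0) +
          (if j < n then g v (j + 1) else \<Sum>u\<in>nbrs ?S v. g u n)"
        unfolding x'(1) sum_nbrs_rooted_path[OF simple_graph_star_graph x'(2) j]
        using j prev y[of "j + 1" v] by (auto simp: yr)
      consider "v = 0" | "v \<in> {1, 2, 3}" | "v = 4" using x'(2) verts by auto
      then have "b * g v j = (if 1 < j then g v (j - 1) else 0) +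
          (if j < n then g v (j + 1) else \<Sum>u\<in>nbrs ?S v. g u n)"
      proof cases
        case 1
        have "(\<Sum>u\<in>nbrs ?S v. g u n) = 3 * (?V n)\<^sup>2 + ?V (n - 1) * ?V (n + 1)"
          unfolding 1 nbrs_star_graph four by (simp add: g_def power2_eq_square)
        moreover have "b * g v j = g v (j - 1) + g v (j + 1)"
          using j 1 by (simp add: g_def mult.assoc[symmetric] rec distrib_right)
        moreover have "g v 0 = 0" using 1 by (simp add: g_def)
        \<comment> \<open>The centre is the one place where the defining equation of
          \<open>b\<close> enters.\<close>
        moreover have "b * g v n = g v (n - 1) + (3 * (?V n)\<^sup>2 + ?V (n - 1) * ?V (n + 1))"
          using eq 1 by (simp add: g_def algebra_simps)
        ultimately show ?thesis
          using j by (cases "j = 1"; cases "j < n") auto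
      next
        case 2
        then have "(\<Sum>u\<in>nbrs ?S v. g u n) = ?V n * ?V (n + 1)"
          by (subst nbrs_star_graph) (auto simp: g_def)
        moreover have "b * g v j = ?V (j - 1) * ?V n + ?V (j + 1) * ?V n"
          using j 2 by (auto simp: g_def mult.assoc[symmetric] rec distrib_right)
        ultimately show ?thesis
          using j 2 by (cases "j = 1"; cases "j < n") (auto simp: g_def)
      next
        case 3
        \<comment> \<open>The deleted vertex has value 0, so its equation, which would fail, is not
          demanded.\<close>
        with nz x'(1) y[OF j] have "j \<noteq> 1" by (auto simp: g_def)
        have "(\<Sum>u\<in>nbrs ?S v. g u n) = ?V n * ?V (n + 1)"
          using 3 by (subst nbrs_star_graph) (auto simp: g_def)
        moreover have "b * g v j = ?V (j - 1 - 1) * ?V (n + 1) + ?V j * ?V (n + 1)"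
        proof -
          have "1 \<le> j - 1" using j \<open>j \<noteq> 1\<close> unfolding atLeastAtMost_iff by linarith
          from rec[OF this] show ?thesis
            using j 3 by (simp add: g_def mult.assoc[symmetric] distrib_right)
        qed
        ultimately show ?thesis
          using j 3 \<open>j \<noteq> 1\<close> by (cases "j < n") (auto simp: g_def)
      qed
      then show ?thesis
        by (simp only: sum[unfolded x'(1)] x'(1) y[OF j] k(2))
    qed
  qed (rule k)
qed

text \<open>\<open>leg_dichotomy\<close> reduces a signed eigenvector to conditions on the root
  values alone; once these vanish, so does every leg.\<close>

lemma cycle_not_eigenvalue:
  fixes b k :: real
  assumes b: "b \<ge> 2" "b < 5/2"
    and eq: "b * path_seq b n * path_seq b (n + 1) =
      2 * path_seq b (n - 1) * path_seq b (n + 1) + 3 * (path_seq b n)\<^sup>2"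
    and k: "k > 0" "k ^ 3 = b"
  defines "H \<equiv> power_hypergraph 3 (rooted_product
      (disjoint_union (cycle_graph 4) (complete_graph 1)) (path_graph n) r)"
  shows "\<not> tensor_eigenvalue (verts H) 3 (adjacency_tensor 3 H) (of_real (k\<^sup>2))"
proof
  let ?G = "disjoint_union (cycle_graph 4) (complete_graph 1)" and ?V = "path_seq b"
  let ?P = "rooted_product ?G (path_graph n) r"
  assume ev: "tensor_eigenvalue (verts H) 3 (adjacency_tensor 3 H) (of_real (k\<^sup>2))"
  have G: "simple_graph ?G"
    by (intro simple_graph_disjoint_union simple_graph_cycle_graph_4 simple_graph_complete_graph)
  have P: "simple_graph ?P"
    by (intro simple_graph_rooted_product G simple_graph_path_graph root_in_path)
  obtain y :: "(nat + nat) \<times> nat \<Rightarrow> complex" and \<epsilon> where nz: "\<exists>x\<in>verts ?P. y x \<noteq> 0"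
    and \<epsilon>: "\<And>e. \<epsilon> e = 1 \<or> \<epsilon> e = -1"
    and y: "\<And>x. x \<in> verts ?P \<Longrightarrow> y x \<noteq> 0 \<Longrightarrow>
      of_real b * y x = (\<Sum>u\<in>nbrs ?P x. \<epsilon> {u, x} * y u)"
    using tensor_eigenvalue_cube_imp[OF P k(1) ev[unfolded H_def]] unfolding k(2) by blast
  define z w v where "z = ?V (n + 1)" and "w = ?V n" and "v = ?V (n - 1)"
  have pos: "z > 0" "w > 0" "v > 0"
    using n path_seq_pos[OF b(1)] by (simp_all add: z_def w_def v_def)
  have zwv: "z = b * w - v"
    using path_seq_rec[of n b] n by (simp add: z_def w_def v_def)
  define d where "d = z / w"
  have "b * w * z = 2 * v * z + 3 * w\<^sup>2"
    using eq by (simp add: z_def w_def v_def)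
  moreover have "b * w = z + v" using zwv by simp
  \<comment> \<open>Substituting b w = z + v eliminates \<open>b\<close>.\<close>
  ultimately have z2: "z\<^sup>2 = v * z + 3 * w\<^sup>2"
    by (simp add: power2_eq_square algebra_simps)
  \<comment> \<open>This is where b < 5/2 is used: it makes 2 z^2 - (5/2) w z - 3 w^2 = (z - 2 w) (2
    z + (3/2) w) negative.\<close>
  have "z < 2 * w"
  proof (rule ccontr)
    assume "\<not> z < 2 * w"
    then have "0 \<le> (z - 2 * w) * (2 * z + 3/2 * w)"
      using pos by (intro mult_nonneg_nonneg) auto
    moreover have "b * (w * z) < 5/2 * (w * z)"
      using b pos by (intro mult_strict_right_mono) auto
    moreover have "2 * z\<^sup>2 = b * (w * z) + 3 * w\<^sup>2"
    proof -
      have "b * w = z + v" using zwv by simp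
      then have "b * (w * z) = (z + v) * z" by (simp flip: mult.assoc)
      with z2 show ?thesis by (simp add: power2_eq_square algebra_simps)
    qed
    moreover have "(z - 2 * w) * (2 * z + 3/2 * w) = 2 * z\<^sup>2 - 5/2 * (w * z) - 3 * w\<^sup>2"
      by (simp add: power2_eq_square field_simps)
    ultimately show False by linarith
  qed
  have d: "d > 0" "3 < d\<^sup>2" "d\<^sup>2 < 4"
  proof -
    show "d > 0" using pos by (simp add: d_def)
    have "3 * w\<^sup>2 < z\<^sup>2" unfolding z2 using pos by simp
    then show "3 < d\<^sup>2" using pos by (simp add: d_def power_divide field_simps)
    have "d < 2" using \<open>z < 2 * w\<close> pos by (simp add: d_def field_simps)
    then show "d\<^sup>2 < 4" using power_strict_mono[of d 2 2] \<open>d > 0\<close> by simp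
  qed
  \<comment> \<open>Hence a deficient leg has ratio w / v = d / (d^2 - 3).\<close>
  have dv: "v / w * d = d\<^sup>2 - 3"
    using z2 pos by (simp add: d_def power_divide field_simps power2_eq_square)
  define C where "C c = (\<Sum>u\<in>nbrs ?G c. \<epsilon> {(u, r), (c, r)} * y (u, r))" for c
  have leg: "norm (y (c, r)) * d \<le> norm (C c)"
      "norm (y (c, r)) * d \<le> norm (C c) * (d\<^sup>2 - 3) \<or> of_real d * y (c, r) = C c"
      "y (c, r) = 0 \<Longrightarrow> j \<in> {1..n} \<Longrightarrow> y (c, q j) = 0"
    if c: "c \<in> verts ?G" for c j
  proof -
    define a where "a j = (if j = 0 then 0 else if j \<le> n then y (c, q j) else C c)" for j
    \<comment> \<open>The edge signs at the root in the base graph are already contained in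
      \<open>C c\<close>, so \<open>E n\<close> is 1; \<open>E 0\<close> only multiplies
      \<open>a 0 = 0\<close>.\<close>
    define E where "E j = (if j < n then \<epsilon> {(c, q j), (c, q (j + 1))} else 1)" for j
    have E: "E j = 1 \<or> E j = -1" for j using \<epsilon> by (simp add: E_def)
    have "of_real b * a j = E (j - 1) * a (j - 1) + E j * a (j + 1)"
      if j: "1 \<le> j" "j \<le> n" "a j \<noteq> 0" for j
    proof -
      have j': "j \<in> {1..n}" and aj: "a j = y (c, q j)" using j by (auto simp: a_def)
      have mem: "(c, q j) \<in> verts ?P"
        using c q[OF j'] by (simp add: rooted_product_def path_graph_def)
      have "of_real b * a j = (\<Sum>u\<in>nbrs ?P (c, q j). \<epsilon> {u, (c, q j)} * y u)"
        using y[OF mem] j(3) unfolding aj by blast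
      also have "\<dots> = (if 1 < j then \<epsilon> {(c, q (j - 1)), (c, q j)} * y (c, q (j - 1)) else 0) +
          (if j < n then \<epsilon> {(c, q (j + 1)), (c, q j)} * y (c, q (j + 1))
           else \<Sum>u\<in>nbrs ?G c. \<epsilon> {(u, r), (c, q j)} * y (u, r))"
        by (rule sum_nbrs_rooted_path[OF G c j'])
      also have "(if 1 < j then \<epsilon> {(c, q (j - 1)), (c, q j)} * y (c, q (j - 1)) else 0) =
          E (j - 1) * a (j - 1)"
        using j by (auto simp: E_def a_def)
      also have "(if j < n then \<epsilon> {(c, q (j + 1)), (c, q j)} * y (c, q (j + 1))
           else \<Sum>u\<in>nbrs ?G c. \<epsilon> {(u, r), (c, q j)} * y (u, r)) = E j * a (j + 1)"
        using j q_n by (auto simp: E_def a_def C_def insert_commute)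
      finally show ?thesis .
    qed
    note dich = leg_dichotomy[of b a E n, OF b(1) _ E this]
    have a: "a 0 = 0" "a n = y (c, r)" "a (Suc n) = C c" "E n = 1"
      using n q_n by (auto simp: a_def E_def)
    have n1: "1 \<le> n" using n by simp
    have est: "norm (a j) * ?V (Suc j) \<le> norm (a (Suc j)) * ?V j" if "j \<le> n" for j
      using dich(1)[OF a(1) _ _ _ n1 that] by blast
    from est[of n] show "norm (y (c, r)) * d \<le> norm (C c)"
      using pos by (simp add: a d_def z_def w_def pos_divide_le_eq del: path_seq.simps)
    have "norm (a n) * ?V n \<le> norm (a (Suc n)) * ?V (n - 1) \<or>
        a n * of_real (?V (Suc n)) = E n * a (Suc n) * of_real (?V n)"
      using dich(2)[OF a(1) _ _ _ n1] by blast
    then show "norm (y (c, r)) * d \<le> norm (C c) * (d\<^sup>2 - 3) \<or> of_real d * y (c, r) = C c"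
    proof
      assume "norm (a n) * ?V n \<le> norm (a (Suc n)) * ?V (n - 1)"
      then have "norm (y (c, r)) \<le> norm (C c) * (v / w)"
        using pos by (simp add: a w_def v_def field_simps)
      then have "norm (y (c, r)) * d \<le> norm (C c) * (v / w) * d"
        using d by (intro mult_right_mono) auto
      then show ?thesis unfolding mult.assoc dv by blast
    next
      assume "a n * of_real (?V (Suc n)) = E n * a (Suc n) * of_real (?V n)"
      then have "y (c, r) * of_real z = C c * of_real w"
        by (simp add: a z_def w_def del: path_seq.simps)
      then show ?thesis
        using pos by (simp add: d_def field_simps)
    qed
    show "y (c, q j) = 0" if "y (c, r) = 0" "j \<in> {1..n}" for j
    proof -
      have "j \<le> n" using that by simp
      \<comment> \<open>By the growth estimate, a zero at m + 1 forces a zero at m, so zeros spread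
        from the root to the far end.\<close>
      then have "a j = 0"
      proof (induction rule: inc_induct)
        case base
        then show ?case using a that by simp
      next
        case (step m)
        have "norm (a m) * ?V (Suc m) \<le> 0" using est[of m] step by simp
        then show ?case using path_seq_pos[OF b(1), of "Suc m"] by (simp add: mult_le_0_iff)
      qed
      then show ?thesis using that by (simp add: a_def)
    qed
  qed
  define Y where "Y i = y (Inl i, r)" for i
  define e where "e i j = \<epsilon> {(Inl i, r), (Inl j, r)}" for i j :: nat
  have e: "e i j = 1 \<or> e i j = -1" and ne: "norm (e i j) = 1" and ecomm: "e i j = e j i" for i j
    using \<epsilon>[of "{(Inl i, r), (Inl j, r)}"] by (auto simp: e_def insert_commute)
  have C_sum: "C (Inl i) = (\<Sum>j\<in>nbrs (cycle_graph 4) i. e j i * Y j)" for i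
    by (simp add: C_def nbrs_disjoint_union sum.reindex e_def Y_def)
  have C: "C (Inl 0) = e 0 1 * Y 1 + e 0 3 * Y 3" "C (Inl 1) = e 0 1 * Y 0 + e 1 2 * Y 2"
    "C (Inl 2) = e 1 2 * Y 1 + e 2 3 * Y 3" "C (Inl 3) = e 0 3 * Y 0 + e 2 3 * Y 2"
    unfolding C_sum nbrs_cycle_graph_4
    by (simp_all add: ecomm[of "Suc 0" 0] ecomm[of 3 0] ecomm[of 2 "Suc 0"] ecomm[of 3 2])
  have C_Inr: "C (Inr i) = 0" for i
    unfolding C_def nbrs_disjoint_union nbrs_complete_graph_1 by simp
  have verts: "verts ?G = {Inl 0, Inl 1, Inl 2, Inl 3, Inr 0}"
    by (auto simp: disjoint_union_def cycle_graph_def complete_graph_def)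
  have tri: "norm (e i j * s + e i' j' * t) \<le> norm s + norm t" for i j i' j' s t
    using norm_triangle_ineq[of "e i j * s" "e i' j' * t"] by (simp add: norm_mult ne)
  have norm_C: "norm (C (Inl 0)) \<le> norm (Y 1) + norm (Y 3)"
    "norm (C (Inl 1)) \<le> norm (Y 0) + norm (Y 2)" "norm (C (Inl 2)) \<le> norm (Y 1) + norm (Y 3)"
    "norm (C (Inl 3)) \<le> norm (Y 0) + norm (Y 2)"
    unfolding C by (rule tri)+
  have le: "d * norm (Y i) \<le> M" if "Inl i \<in> verts ?G" "norm (C (Inl i)) \<le> M" for i M
    using leg(1)[OF that(1)] that(2) by (simp add: Y_def mult.commute)
  have deficient: "d * norm (Y i) \<le> (d\<^sup>2 - 3) * M \<or> of_real d * Y i = C (Inl i)"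
    if "Inl i \<in> verts ?G" "norm (C (Inl i)) \<le> M" for i M
  proof -
    have "norm (C (Inl i)) * (d\<^sup>2 - 3) \<le> (d\<^sup>2 - 3) * M"
      using that(2) d(2) by (subst mult.commute) (intro mult_left_mono; simp)
    then show ?thesis
      using leg(2)[OF that(1)] by (auto simp: Y_def mult.commute)
  qed
  have "Y 0 = 0 \<and> Y 1 = 0 \<and> Y 2 = 0 \<and> Y 3 = 0"
  proof -
    have V: "Inl 0 \<in> verts ?G" "Inl 1 \<in> verts ?G" "Inl 2 \<in> verts ?G" "Inl 3 \<in> verts ?G"
      unfolding verts by simp_all
    note bound = le[OF V(1) norm_C(1)] le[OF V(2) norm_C(2)] le[OF V(3) norm_C(3)]
      le[OF V(4) norm_C(4)]
    \<comment> \<open>Either all four legs obey the exact relation, or some leg is deficient; in the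
      latter case \<open>cycle_deficient\<close> is applied with the opposite vertex as s.\<close>
    consider (exact) "of_real d * Y 0 = C (Inl 0)" "of_real d * Y 1 = C (Inl 1)"
        "of_real d * Y 2 = C (Inl 2)" "of_real d * Y 3 = C (Inl 3)"
      | (0) "d * norm (Y 0) \<le> (d\<^sup>2 - 3) * (norm (Y 1) + norm (Y 3))"
      | (1) "d * norm (Y 1) \<le> (d\<^sup>2 - 3) * (norm (Y 0) + norm (Y 2))"
      | (2) "d * norm (Y 2) \<le> (d\<^sup>2 - 3) * (norm (Y 1) + norm (Y 3))"
      | (3) "d * norm (Y 3) \<le> (d\<^sup>2 - 3) * (norm (Y 0) + norm (Y 2))"
      using deficient[OF V(1) norm_C(1)] deficient[OF V(2) norm_C(2)]
        deficient[OF V(3) norm_C(3)] deficient[OF V(4) norm_C(4)] by blast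
    then show ?thesis
    proof cases
      case exact
      show ?thesis
        by (rule cycle_exact[OF d(2,3) e[of 0 1] e[of 1 2] e[of 2 3] e[of 0 3]
              exact(1)[unfolded C] exact(2)[unfolded C] exact(3)[unfolded C]
              exact(4)[unfolded C, THEN trans, OF add.commute]])
    next
      case 0
      then show ?thesis
        using cycle_deficient[OF d(1,3) _ _ _ _ 0, of "norm (Y 2)"] bound by (simp add: add.commute)
    next
      case 1
      then show ?thesis
        using cycle_deficient[OF d(1,3) _ _ _ _ 1, of "norm (Y 3)"] bound by (simp add: add.commute)
    next
      case 2
      then show ?thesis
        using cycle_deficient[OF d(1,3) _ _ _ _ 2, of "norm (Y 0)"] bound
        by (simp add: add.commute)
    next
      case 3
      then show ?thesis
        using cycle_deficient[OF d(1,3) _ _ _ _ 3, of "norm (Y 1)"] bound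
        by (simp add: add.commute)
    qed
  qed
  \<comment> \<open>The isolated vertex has no neighbours in the base graph, so its leg continues to
    0 at position n + 1.\<close>
  moreover have "y (Inr 0, r) = 0"
  proof -
    have "Inr 0 \<in> verts ?G" unfolding verts by simp
    from leg(1)[OF this] d(1) show ?thesis by (simp add: C_Inr mult_le_0_iff)
  qed
  ultimately have "y (c, r) = 0" if "c \<in> verts ?G" for c
    using that unfolding verts by (auto simp: Y_def)
  then have "y x = 0" if "x \<in> verts ?P" for x
    using that leg(3) by (metis verts_rooted_pathE)
  with nz show False by blast
qed

end

section \<open>Comparison of the spectra of the third powers\<close>

theorem corollary4p15:
  fixes n r :: nat
  assumes "n \<ge> 2"
    and "pendent_vertex (path_graph n) r"
  shows "\<not> high_ordered_cospectral
           (rooted_product (star_graph 4) (path_graph n) r)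
           (rooted_product (disjoint_union (cycle_graph 4) (complete_graph 1)) (path_graph n) r)"
    (is "\<not> high_ordered_cospectral ?G1 ?G2")
proof
  assume "high_ordered_cospectral ?G1 ?G2"
  then obtain S where S: "is_spectrum 3 (power_hypergraph 3 ?G1) S"
    "is_spectrum 3 (power_hypergraph 3 ?G2) S"
    unfolding high_ordered_cospectral_def by (elim allE[of _ 3]) auto
  obtain q ht where "rooted_path n r q ht"
    using assms by (rule rooted_path_exists)
  then interpret rooted_path n r q ht .
  have n1: "1 \<le> n - 1" and Sn: "Suc (n - 1) = n"
    using n by linarith+
  obtain b where b: "2 \<le> b" "b < 5/2" and eq: "b * path_seq b n * path_seq b (n + 1) =
      2 * path_seq b (n - 1) * path_seq b (n + 1) + 3 * (path_seq b n)\<^sup>2"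
    using exists_path_seq_eq[OF n1] unfolding Sn unfolding Suc_eq_plus1 by blast
  \<comment> \<open>An eigenvalue \<open>b\<close> of a signed induced subgraph corresponds to the
    eigenvalue b^(2/3) of the cube.\<close>
  define k where "k = root 3 b"
  have k: "k > 0" "k ^ 3 = b"
    using b by (simp_all add: k_def)
  have simple: "simple_graph ?G1" "simple_graph ?G2"
    by (intro simple_graph_rooted_product simple_graph_star_graph simple_graph_path_graph
        simple_graph_disjoint_union simple_graph_cycle_graph_4 simple_graph_complete_graph
        root_in_path)+
  have "of_real (k\<^sup>2) \<in># S"
    using star_eigenvalue[OF b(1) eq k] simple(1)
    by (simp add: spectrum_iff_tensor_eigenvalue[OF S(1)] finite_verts_cube)
  moreover have "of_real (k\<^sup>2) \<notin># S"
    using cycle_not_eigenvalue[OF b eq k] simple(2)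
    by (simp add: spectrum_iff_tensor_eigenvalue[OF S(2)] finite_verts_cube)
  ultimately show False by contradiction
qed

end
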